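(* For every integer $d\ge 1$ there is a constant $C(d)>0$, depending only on $d$, such that for every $n\ge 1$, every real multi-indexed matrix $A=(a_{\mathbf i})_{1\le i_1,\dots,i_d\le n}$ of order $d$ and every real $p\ge 2$, $$\frac{1}{C(d)}\,m_p(A)\le\left\|\sum_{\mathbf i}a_{\mathbf i}\prod_{j=1}^d g^{(j)}_{i_j}\right\|_p\le C(d)\,m_p(A),$$ where $g_i^{(j)}$ ($1\le i\le n$, $1\le j\le d$) are independent standard $\mathcal N(0,1)$ random variables.
   Context: For a real random variable $X$, $\|X\|_p=(\mathbf E|X|^p)^{1/p}$. A matrix of order $d$ is a finite real array $A=(a_{\mathbf i})$ indexed by $\mathbf i=(i_1,\dots,i_d)\in\{1,\dots,n\}^d$. For $I\subset\{1,\dots,d\}$ put $i_I:=(i_j)_{j\in I}$. For a partition of $\{1,\dots,d\}$ into nonempty disjoint sets $I_1,\dots,I_k$ put $$\|A\|_{I_1,\dots,I_k}:=\sup\Big\{\sum_{\mathbf i}a_{\mathbf i}\,x^{(1)}_{i_{I_1}}\cdots x^{(k)}_{i_{I_k}}:\ \sum_{i_{I_1}}(x^{(1)}_{i_{I_1}})^2\le 1,\dots,\sum_{i_{I_k}}(x^{(k)}_{i_{I_k}})^2\le 1\Big\},$$ where each $x^{(l)}=(x^{(l)}_{i_{I_l}})$ is a real array indexed by $i_{I_l}\in\{1,\dots,n\}^{I_l}$. Let $S(k,d)$ be the set of all partitions of $\{1,\dots,d\}$ into $k$ nonempty disjoint sets $I_1,\dots,I_k$. For $p\ge 1$, $$m_p(A):=\sum_{k=1}^d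 p^{k/2}\sum_{(I_1,\dots,I_k)\in S(k,d)}\|A\|_{I_1,\dots,I_k}.$$ *)

theory Defs
  imports "HOL-Probability.Probability" "HOL-Library.Disjoint_Sets"
begin

text \<open>
  For \<open>I \<subseteq> {1..d}\<close>, the multi-indices \<open>i\<^sub>I\<close> over \<open>{1..n}\<close> are the extensional functions in
  \<open>multi_indices I n\<close>. A matrix of order \<open>d\<close> is a function \<open>(nat \<Rightarrow> nat) \<Rightarrow> real\<close>
  of which only the values on \<open>multi_indices {1..d} n\<close> are ever used.
\<close>

definition multi_indices :: "nat set \<Rightarrow> nat \<Rightarrow> (nat \<Rightarrow> nat) set" where
  "multi_indices I n = I \<rightarrow>\<^sub>E {1..n}"

text \<open>
  The arrays \<open>x\<close> are labelled by the blocks of the partition \<open>P\<close> themselves. The supremum is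
  taken over a nonempty set that is bounded above (Cauchy-Schwarz).
\<close>

definition partition_norm ::
    "nat \<Rightarrow> nat \<Rightarrow> ((nat \<Rightarrow> nat) \<Rightarrow> real) \<Rightarrow> nat set set \<Rightarrow> real" where
  "partition_norm d n A P =
     Sup {\<Sum>i\<in>multi_indices {1..d} n. A i * (\<Prod>I\<in>P. x I (restrict i I)) | x.
            \<forall>I\<in>P. (\<Sum>u\<in>multi_indices I n. (x I u)\<^sup>2) \<le> 1}"

definition partitions_into :: "nat \<Rightarrow> nat \<Rightarrow> nat set set set" where
  "partitions_into k d = {P. partition_on {1..d} P \<and> card P = k}"

definition m_norm :: "nat \<Rightarrow> nat \<Rightarrow> real \<Rightarrow> ((nat \<Rightarrow> nat) \<Rightarrow> real) \<Rightarrow> real" where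
  "m_norm d n p A =
     (\<Sum>k=1..d. p powr (real k / 2) * (\<Sum>P\<in>partitions_into k d. partition_norm d n A P))"

definition Lp_norm :: "'w measure \<Rightarrow> real \<Rightarrow> ('w \<Rightarrow> real) \<Rightarrow> real" where
  "Lp_norm M p X = (\<integral>\<omega>. \<bar>X \<omega>\<bar> powr p \<partial>M) powr (1 / p)"

definition indep_std_normals ::
    "'w measure \<Rightarrow> nat \<Rightarrow> nat \<Rightarrow> (nat \<Rightarrow> nat \<Rightarrow> 'w \<Rightarrow> real) \<Rightarrow> bool" where
  "indep_std_normals M d n g \<longleftrightarrow>
     prob_space.indep_vars M (\<lambda>_. borel) (\<lambda>(j, i). g j i) ({1..d} \<times> {1..n}) \<and>
     (\<forall>j\<in>{1..d}. \<forall>i\<in>{1..n}. distributed M lborel (g j i) std_normal_density)"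

definition decoupled_chaos ::
    "nat \<Rightarrow> nat \<Rightarrow> ((nat \<Rightarrow> nat) \<Rightarrow> real) \<Rightarrow> (nat \<Rightarrow> nat \<Rightarrow> 'w \<Rightarrow> real) \<Rightarrow> 'w \<Rightarrow> real" where
  "decoupled_chaos d n A g \<omega> =
     (\<Sum>i\<in>multi_indices {1..d} n. A i * (\<Prod>j=1..d. g j (i j) \<omega>))"

text \<open>
  The two-sided moment estimate of order \<open>d\<close> with constant \<open>C\<close>, for all probability spaces whose
  sample space has type \<open>'w\<close>. The type argument is explicit so that independence of \<open>C\<close> from the
  sample space type can be expressed: in \<open>\<exists>C. moment_bounds TYPE('w) d C\<close> alone, \<open>C\<close> could
  depend on \<open>'w\<close>. Every joint law of \<open>(g j i)\<close> is realised by the coordinate maps on the sample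
  space type \<open>nat \<times> nat \<Rightarrow> real\<close>, so \<open>C\<close> is uniform over all \<open>'w\<close> iff it can be found for that
  type and is then valid for every other one.
\<close>

definition moment_bounds :: "'w itself \<Rightarrow> nat \<Rightarrow> real \<Rightarrow> bool" where
  "moment_bounds _ d C \<longleftrightarrow>
     (\<forall>n\<ge>1. \<forall>A. \<forall>p\<ge>2. \<forall>(M :: 'w measure) g.
        prob_space M \<longrightarrow> indep_std_normals M d n g \<longrightarrow>
          1 / C * m_norm d n p A \<le> Lp_norm M p (decoupled_chaos d n A g) \<and>
          Lp_norm M p (decoupled_chaos d n A g) \<le> C * m_norm d n p A)"

end

theory Submission
  imports Defs
begin

text \<open>
  Conditionally on one row \<open>g\<close> of Gaussians, the chaos of \<open>A\<close> is the chaos of the random contraction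
  \<open>A(g)\<close>, which has one index less. Hence both estimates follow by induction on the number of
  indices from a comparison of the norms \<open>p\<^bsup>|P|/2\<^esup> \<parallel>A(g)\<parallel>\<^sub>P\<close> with those of \<open>A\<close>.

  Upper estimate. Let \<open>f\<^sub>g(x)\<close> be the multilinear form of \<open>A(g)\<close> for the partition \<open>P\<close>; for fixed \<open>x\<close>
  it is a centred Gaussian variable in \<open>g\<close>, of variance \<open>\<sigma>\<^sup>2(x)\<close>. No chaining is needed to bound its
  supremum: shift independent standard Gaussian arrays \<open>\<theta>\<close> by \<open>sqrt p x\<close>. The shift leaves the mean of
  the multilinear form unchanged and costs a density whose relative entropy is at most \<open>p/2\<close> for every
  block, so Jensen's inequality gives
  \<open>exp (c f\<^sub>g(sqrt p x)) \<le> exp (c\<^sup>2/2 E \<sigma>\<^sup>2(sqrt p x + \<theta>) + p|P|/2) Z(g)\<close>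
  for all unit arrays \<open>x\<close> simultaneously, where \<open>Z(g) = E\<^sub>\<theta> exp (c f\<^sub>g(\<theta>) - c\<^sup>2/2 \<sigma>\<^sup>2(\<theta>))\<close> has mean \<open>1\<close>.
  Expanding \<open>E \<sigma>\<^sup>2\<close> over the subsets \<open>S\<close> of \<open>P\<close> produces the norms of \<open>A\<close> for the partitions that merge
  the blocks in \<open>S\<close> with the new index, with exactly the right powers of \<open>p\<close>. Finally \<open>c = p/s\<close>, where
  \<open>s\<close> bounds the weighted norms of \<open>A\<close>.

  Lower estimate. If the new index is a block of its own, the form is a Gaussian variable in \<open>g\<close>, whose
  \<open>p\<close>-th moment contributes the factor \<open>sqrt p\<close>. Otherwise the array of its block may be chosen
  depending on \<open>g\<close>, and the \<open>p\<close>-th moment of a Euclidean norm dominates the second one.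
\<close>

section \<open>Exponential tilts of Gaussian vectors\<close>

abbreviation std_gauss :: "real measure" where
  "std_gauss \<equiv> density lborel std_normal_density"

definition gauss :: "'a set \<Rightarrow> ('a \<Rightarrow> real) measure" where
  "gauss J = Pi\<^sub>M J (\<lambda>_. std_gauss)"

text \<open>The Cameron-Martin density: for finite \<open>J\<close>, this is the density of the law
  of \<open>g + c\<close> with respect to the law \<open>gauss J\<close> of \<open>g\<close>, so
  weighted integrals are expectations after a shift by \<open>c\<close>.\<close>

definition tilt :: "'a set \<Rightarrow> ('a \<Rightarrow> real) \<Rightarrow> ('a \<Rightarrow> real) \<Rightarrow> real" where
  "tilt J c g = exp (\<Sum>j\<in>J. c j * g j - (c j)\<^sup>2 / 2)"

lemma prob_space_std_gauss: "prob_space std_gauss"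
  by (rule prob_space_normal_density) simp

lemma sets_gauss [measurable_cong]: "sets (gauss J) = sets (Pi\<^sub>M J (\<lambda>_. borel))"
  unfolding gauss_def by (intro sets_PiM_cong) auto

lemma prob_space_gauss: "prob_space (gauss J)"
  unfolding gauss_def by (intro prob_space_PiM prob_space_std_gauss)

lemma product_sigma_finite_gauss: "product_sigma_finite (\<lambda>_. std_gauss)"
  by (intro product_sigma_finite.intro prob_space_imp_sigma_finite prob_space_std_gauss)

lemma product_sigma_finite_gauss_family: "product_sigma_finite (\<lambda>I. gauss (J I))"
  by (intro product_sigma_finite.intro prob_space_imp_sigma_finite prob_space_gauss)

lemma measurable_coord: "j \<in> J \<Longrightarrow> (\<lambda>g. g j) \<in> borel_measurable (gauss J)"
  by measurable

text \<open>By completing the square, the standard density times the tilt is the density of the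
  normal law with mean \<open>c\<close> and variance \<open>1\<close>, whose mass, mean and second
  moment these are.\<close>

lemma std_gauss_tilt_moments:
  fixes c :: real
  shows "has_bochner_integral std_gauss (\<lambda>t. exp (c * t - c\<^sup>2 / 2)) 1"
    and "has_bochner_integral std_gauss (\<lambda>t. t * exp (c * t - c\<^sup>2 / 2)) c"
    and "has_bochner_integral std_gauss (\<lambda>t. t * t * exp (c * t - c\<^sup>2 / 2)) (c * c + 1)"
proof -
  have eq: "normal_density c 1 t = std_normal_density t * exp (c * t - c\<^sup>2 / 2)" for t
    by (simp add: normal_density_def power2_eq_square field_simps flip: exp_add)
  have m0: "has_bochner_integral lborel (\<lambda>t. normal_density c 1 t) 1"
    using normal_moment_even[of 1 c 0] by simp
  have m1: "has_bochner_integral lborel (\<lambda>t. normal_density c 1 t * (t - c)) 0"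
    using normal_moment_odd[of 1 c 0] by simp
  have m2: "has_bochner_integral lborel (\<lambda>t. normal_density c 1 t * (t - c)\<^sup>2) 1"
    using normal_moment_even[of 1 c 1] by (simp add: fact_numeral)
  have n1: "has_bochner_integral lborel (\<lambda>t. normal_density c 1 t * t) c"
    using has_bochner_integral_add[OF m1 has_bochner_integral_mult_right[OF m0, of c]]
    by (simp add: algebra_simps)
  have n2: "has_bochner_integral lborel (\<lambda>t. normal_density c 1 t * (t * t)) (c * c + 1)"
  proof -
    have "normal_density c 1 t * (t * t) = normal_density c 1 t * (t - c)\<^sup>2
        + (2 * c * (normal_density c 1 t * (t - c)) + c * c * normal_density c 1 t)" for t
      by (simp add: power2_eq_square algebra_simps)
    then show ?thesis
      using has_bochner_integral_add[OF m2 has_bochner_integral_add[OF has_bochner_integral_mult_right[OF m1, of "2 * c"]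
        has_bochner_integral_mult_right[OF m0, of "c * c"]]] by (simp add: add.commute)
  qed
  show "has_bochner_integral std_gauss (\<lambda>t. exp (c * t - c\<^sup>2 / 2)) 1"
    by (rule has_bochner_integral_density) (use m0 in \<open>auto simp: eq\<close>)
  show "has_bochner_integral std_gauss (\<lambda>t. t * exp (c * t - c\<^sup>2 / 2)) c"
    by (rule has_bochner_integral_density) (use n1 in \<open>auto simp: eq ac_simps\<close>)
  show "has_bochner_integral std_gauss (\<lambda>t. t * t * exp (c * t - c\<^sup>2 / 2)) (c * c + 1)"
    by (rule has_bochner_integral_density) (use n2 in \<open>auto simp: eq ac_simps\<close>)
qed

lemma has_bochner_integral_PiM_prod:
  fixes f :: "'i \<Rightarrow> 'a \<Rightarrow> real"
  assumes "product_sigma_finite M" "finite I" "\<And>i. i \<in> I \<Longrightarrow> has_bochner_integral (M i) (f i) (m i)"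
  shows "has_bochner_integral (Pi\<^sub>M I M) (\<lambda>x. \<Prod>i\<in>I. f i (x i)) (\<Prod>i\<in>I. m i)"
proof -
  interpret product_sigma_finite M by fact
  have "integrable (M i) (f i)" "integral\<^sup>L (M i) (f i) = m i" if "i \<in> I" for i
    using assms(3)[OF that] by (auto simp: has_bochner_integral_iff)
  with assms(2) show ?thesis
    by (simp add: has_bochner_integral_iff product_integrable_prod product_integral_prod)
qed

lemma tilt_prod: "finite J \<Longrightarrow> tilt J c = (\<lambda>g. \<Prod>j\<in>J. exp (c j * g j - (c j)\<^sup>2 / 2))"
  by (simp add: tilt_def exp_sum fun_eq_iff)

lemma gauss_tilt_mass:
  assumes "finite J"
  shows "has_bochner_integral (gauss J) (tilt J c) 1"
  using has_bochner_integral_PiM_prod[OF product_sigma_finite_gauss assms std_gauss_tilt_moments(1), of c]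
  by (simp add: gauss_def tilt_prod[OF assms])

text \<open>The factor \<open>g u\<close> is read as a product over \<open>J\<close> with factor
  \<open>1\<close> off \<open>u\<close>, so the integral splits into one-dimensional ones.\<close>

lemma gauss_tilt_mean:
  assumes "finite J" "u \<in> J"
  shows "has_bochner_integral (gauss J) (\<lambda>g. g u * tilt J c g) (c u)"
proof -
  have "has_bochner_integral (gauss J)
    (\<lambda>g. \<Prod>j\<in>J. (if j = u then g j else 1) * exp (c j * g j - (c j)\<^sup>2 / 2)) (\<Prod>j\<in>J. if j = u then c j else 1)"
    unfolding gauss_def
    by (rule has_bochner_integral_PiM_prod[OF product_sigma_finite_gauss assms(1)])
       (auto intro: std_gauss_tilt_moments)
  then show ?thesis
    using assms by (simp add: tilt_prod prod.distrib)
qed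

lemma gauss_tilt_cov:
  assumes "finite J" "u \<in> J" "v \<in> J"
  shows "has_bochner_integral (gauss J) (\<lambda>g. g u * g v * tilt J c g) (c u * c v + of_bool (u = v))"
proof -
  \<comment> \<open>For \<open>u = v\<close> both factors sit on one coordinate and contribute its
    second moment; otherwise they sit on two coordinates and contribute means.\<close>
  let ?m = "\<lambda>j. if u = v then if j = u then c j * c j + 1 else 1
      else (if j = u then c j else 1) * (if j = v then c j else 1)"
  have "has_bochner_integral (gauss J)
    (\<lambda>g. \<Prod>j\<in>J. (if j = u then g j else 1) * (if j = v then g j else 1) * exp (c j * g j - (c j)\<^sup>2 / 2)) 
     (\<Prod>j\<in>J. ?m j)"
    unfolding gauss_def
    by (rule has_bochner_integral_PiM_prod[OF product_sigma_finite_gauss assms(1)])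
       (auto intro: std_gauss_tilt_moments)
  then show ?thesis
    using assms by (cases "u = v") (simp_all add: tilt_prod prod.distrib)
qed

lemma tilt_pos: "0 < tilt J c g"
  by (simp add: tilt_def)

lemma nn_integral_tilt: "finite J \<Longrightarrow> (\<integral>\<^sup>+g. ennreal (tilt J c g) \<partial>gauss J) = 1"
  using gauss_tilt_mass[of J c] tilt_pos[of J c]
  by (simp add: less_imp_le nn_integral_eq_integral has_bochner_integral_iff)

text \<open>Linearity under a fixed weight \<open>w\<close>, in practice a tilt. Double sums are
  handled by iterating it, which is why coefficients \<open>1\<close> are inserted in its
  applications.\<close>

lemma sum_has_bochner_integral_coeff:
  fixes a :: "'i \<Rightarrow> real"
  assumes "\<And>i. i \<in> I \<Longrightarrow> has_bochner_integral M (\<lambda>x. f i x * w x) (m i)"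
  shows "has_bochner_integral M (\<lambda>x. (\<Sum>i\<in>I. a i * f i x) * w x) (\<Sum>i\<in>I. a i * m i)"
proof -
  have "has_bochner_integral M (\<lambda>x. \<Sum>i\<in>I. a i * (f i x * w x)) (\<Sum>i\<in>I. a i * m i)"
    by (intro has_bochner_integral_sum has_bochner_integral_mult_right assms)
  then show ?thesis by (simp add: sum_distrib_right mult.assoc)
qed

text \<open>If the right-hand side is finite, then \<open>f\<close> is integrable and dominates
  \<open>h\<close>. Moments can thus be bounded below before their finiteness is known.\<close>

lemma integral_le_nn_integral:
  fixes f h :: "'a \<Rightarrow> real"
  assumes h: "has_bochner_integral M h a" and f: "f \<in> borel_measurable M" "\<And>x. 0 \<le> f x" "\<And>x. h x \<le> f x"
  shows "ennreal a \<le> (\<integral>\<^sup>+x. ennreal (f x) \<partial>M)"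
proof (cases "(\<integral>\<^sup>+x. ennreal (f x) \<partial>M) = top")
  case False
  have int: "integrable M f"
    using False f by (intro integrableI_nonneg) (auto simp: top.not_eq_extremum)
  have "a = integral\<^sup>L M h" "integrable M h"
    using h by (auto simp: has_bochner_integral_iff)
  then have "a \<le> integral\<^sup>L M f"
    using int f(3) integral_mono by metis
  then show ?thesis
    using int f(2) by (simp add: nn_integral_eq_integral ennreal_leI)
qed simp

text \<open>Jensen's inequality for \<open>exp\<close> under the probability measure with density
  \<open>W\<close>, from the tangent line of \<open>exp\<close> at the mean
  \<open>a\<close>.\<close>

lemma exp_integral_le_nn_integral:
  fixes W Y :: "'a \<Rightarrow> real"
  assumes W: "has_bochner_integral M W 1" "\<And>x. 0 \<le> W x"
    and Y: "has_bochner_integral M (\<lambda>x. Y x * W x) a" "Y \<in> borel_measurable M"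
  shows "ennreal (exp a) \<le> (\<integral>\<^sup>+x. ennreal (exp (Y x) * W x) \<partial>M)"
proof (rule integral_le_nn_integral)
  note borel_measurable_has_bochner_integral[OF W(1), measurable] Y(2) [measurable]
  show "(\<lambda>x. exp (Y x) * W x) \<in> borel_measurable M" by measurable
  have "has_bochner_integral M (\<lambda>x. exp a * (1 - a) * W x + exp a * (Y x * W x)) (exp a * (1 - a) * 1 + exp a * a)"
    by (intro has_bochner_integral_add has_bochner_integral_mult_right assms)
  then show "has_bochner_integral M (\<lambda>x. exp a * (1 - a) * W x + exp a * (Y x * W x)) (exp a)"
    by (simp add: algebra_simps)
  fix x
  have "exp a * (1 + (Y x - a)) \<le> exp a * exp (Y x - a)"
    by (intro mult_left_mono exp_ge_add_one_self) auto
  also have "\<dots> = exp (Y x)" by (simp flip: exp_add)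
  finally have "exp a * (1 + (Y x - a)) * W x \<le> exp (Y x) * W x"
    using W(2) mult_right_mono by blast
  then show "exp a * (1 - a) * W x + exp a * (Y x * W x) \<le> exp (Y x) * W x"
    by (simp add: algebra_simps)
qed (use W(2) in auto)

text \<open>Young's inequality \<open>t * w \<le> t powr p / p + w powr q / q\<close> is applied to the exponential tilt \<open>w\<close>
  towards the direction of \<open>c\<close>, which moves the mean of the Gaussian variable to \<open>sqrt p\<close> times
  its standard deviation.\<close>
lemma gauss_linear_moment_ge:
  fixes c :: "'a \<Rightarrow> real"
  assumes J: "finite J" and p: "p \<ge> 2"
  shows "ennreal ((sqrt p * sqrt (\<Sum>j\<in>J. (c j)\<^sup>2) / 9) powr p)
    \<le> (\<integral>\<^sup>+g. ennreal (\<bar>\<Sum>j\<in>J. c j * g j\<bar> powr p) \<partial>gauss J)"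
proof (cases "(\<Sum>j\<in>J. (c j)\<^sup>2) = 0")
  case False
  define s where "s = sqrt (\<Sum>j\<in>J. (c j)\<^sup>2)"
  have sp: "s > 0" and s2: "s\<^sup>2 = (\<Sum>j\<in>J. (c j)\<^sup>2)"
    using False by (auto simp: s_def sum_nonneg less_le)
  \<comment> \<open>The exponent conjugate to \<open>p\<close>; \<open>p \<ge> 2\<close> keeps it at
    most \<open>2\<close>.\<close>
  define q where "q = p / (p - 1)"
  have q: "q > 1" "q \<le> 2" "1 / p + 1 / q = 1" "p * (q - 1) = q"
    using p by (auto simp: q_def field_simps)
  \<comment> \<open>The direction of \<open>c\<close>, scaled to squared length
    \<open>p\<close>.\<close>
  define x where "x = (\<lambda>j. sqrt p / s * c j)"
  have x2: "(\<Sum>j\<in>J. (x j)\<^sup>2) = p"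
  proof -
    have "(\<Sum>j\<in>J. (x j)\<^sup>2) = p / s\<^sup>2 * (\<Sum>j\<in>J. (c j)\<^sup>2)"
      using p by (simp add: x_def power_mult_distrib power_divide sum_distrib_left)
    with sp show ?thesis by (simp flip: s2)
  qed
  \<comment> \<open>The mean \<open>sqrt p * s\<close> divided by \<open>K\<close> is
    \<open>9\<close>, which leaves \<open>1\<close> after the error term of mass \<open>8\<close>
    below is subtracted.\<close>
  define K where "K = sqrt p * s / 9"
  have K: "K > 0" using p sp by (simp add: K_def)
  define G where "G = (\<lambda>g. \<Sum>j\<in>J. c j * g j)"
  have G_meas [measurable]: "G \<in> borel_measurable (gauss J)" unfolding G_def by measurable
  have "has_bochner_integral (gauss J) (\<lambda>g. G g * tilt J x g) (\<Sum>j\<in>J. c j * x j)"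
    unfolding G_def by (intro sum_has_bochner_integral_coeff gauss_tilt_mean J)
  also have "(\<Sum>j\<in>J. c j * x j) = sqrt p * s"
  proof -
    have "(\<Sum>j\<in>J. c j * x j) = sqrt p / s * s\<^sup>2"
      unfolding x_def s2 sum_distrib_left by (intro sum.cong) (auto simp: power2_eq_square)
    with sp show ?thesis by (simp add: power2_eq_square)
  qed
  finally have mean: "has_bochner_integral (gauss J) (\<lambda>g. G g * tilt J x g) (sqrt p * s)" .
  \<comment> \<open>A power of a tilt is a constant times a tilt; since
    \<open>p * (q - 1) = q\<close>, the constant stays bounded in \<open>p\<close>.\<close>
  have tq: "tilt J x g powr q = exp (q\<^sup>2 / 2) * tilt J (\<lambda>j. q * x j) g" for g
  proof -
    have "q * (\<Sum>j\<in>J. x j * g j - (x j)\<^sup>2 / 2)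
        = (\<Sum>j\<in>J. ((q * x j) * g j - (q * x j)\<^sup>2 / 2) + (q\<^sup>2 - q) / 2 * (x j)\<^sup>2)"
      unfolding sum_distrib_left by (intro sum.cong) (auto simp: field_simps power2_eq_square)
    also have "\<dots> = (\<Sum>j\<in>J. (q * x j) * g j - (q * x j)\<^sup>2 / 2) + (q\<^sup>2 - q) / 2 * (\<Sum>j\<in>J. (x j)\<^sup>2)"
      by (simp add: sum.distrib sum_distrib_left)
    also have "(q\<^sup>2 - q) / 2 * (\<Sum>j\<in>J. (x j)\<^sup>2) = q\<^sup>2 / 2"
    proof -
      have "(q\<^sup>2 - q) * p = q * (p * (q - 1))" by (simp add: power2_eq_square algebra_simps)
      then show ?thesis unfolding x2 q(4) by (simp add: power2_eq_square)
    qed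
    finally show ?thesis
      by (simp add: tilt_def powr_def mult.commute flip: exp_add)
  qed
  have young: "1 / K * (G g * tilt J x g) \<le> (\<bar>G g\<bar> / K) powr p / p + 8 * tilt J (\<lambda>j. q * x j) g" for g
  proof -
    have "1 / K * (G g * tilt J x g) \<le> (\<bar>G g\<bar> / K) * tilt J x g"
      using K tilt_pos[of J x g] by (simp add: divide_simps mult_right_mono)
    also have "\<dots> \<le> (\<bar>G g\<bar> / K) powr p / p + tilt J x g powr q / q"
      using K tilt_pos[of J x g] p q by (intro Youngs_inequality) auto
    also have "tilt J x g powr q / q \<le> tilt J x g powr q"
      using q by (simp add: divide_le_eq mult_le_cancel_left1)
    also have "\<dots> \<le> 8 * tilt J (\<lambda>j. q * x j) g"
    proof -
      have "exp (q\<^sup>2 / 2) \<le> exp 2"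
        using q power_mono[of q 2 2] by simp
      also have "\<dots> = exp 1 * exp (1 :: real)" by (simp flip: exp_add)
      also have "\<dots> \<le> 8"
        using e_less_272 mult_mono[of "exp 1" "272 / 100" "exp 1" "272 / 100 :: real"] by simp
      finally show ?thesis unfolding tq by (rule mult_right_mono) (simp add: tilt_pos less_imp_le)
    qed
    finally show ?thesis by simp
  qed
  have "ennreal 1 \<le> (\<integral>\<^sup>+g. ennreal ((\<bar>G g\<bar> / K) powr p / p) \<partial>gauss J)"
  proof (rule integral_le_nn_integral)
    have "has_bochner_integral (gauss J) (\<lambda>g. 1 / K * (G g * tilt J x g) - 8 * tilt J (\<lambda>j. q * x j) g)
      (1 / K * (sqrt p * s) - 8 * 1)"
      by (intro has_bochner_integral_diff has_bochner_integral_mult_right mean gauss_tilt_mass J)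
    then show "has_bochner_integral (gauss J) (\<lambda>g. 1 / K * (G g * tilt J x g) - 8 * tilt J (\<lambda>j. q * x j) g) 1"
      using p sp by (simp add: K_def)
    show "1 / K * (G g * tilt J x g) - 8 * tilt J (\<lambda>j. q * x j) g \<le> (\<bar>G g\<bar> / K) powr p / p" for g
      using young[of g] by simp
  qed (use p in auto)
  also have "\<dots> \<le> (\<integral>\<^sup>+g. ennreal ((\<bar>G g\<bar> / K) powr p) \<partial>gauss J)"
    using p by (intro nn_integral_mono ennreal_leI) (simp add: divide_le_eq mult_le_cancel_left1)
  finally have "1 \<le> (\<integral>\<^sup>+g. ennreal ((\<bar>G g\<bar> / K) powr p) \<partial>gauss J)" by simp
  then have "ennreal (K powr p) * 1 \<le> ennreal (K powr p) * (\<integral>\<^sup>+g. ennreal ((\<bar>G g\<bar> / K) powr p) \<partial>gauss J)"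
    by (intro mult_left_mono) auto
  also have "\<dots> = (\<integral>\<^sup>+g. ennreal (\<bar>G g\<bar> powr p) \<partial>gauss J)"
    using K by (simp add: powr_divide flip: nn_integral_cmult ennreal_mult')
  finally show ?thesis
    by (simp add: K_def s_def G_def)
qed (use J in \<open>simp add: sum_nonneg_eq_0_iff\<close>)

lemma gauss_linear_square:
  assumes "finite J"
  shows "has_bochner_integral (gauss J) (\<lambda>g. (\<Sum>j\<in>J. c j * g j)\<^sup>2) (\<Sum>j\<in>J. (c j)\<^sup>2)"
proof -
  \<comment> \<open>The tilt by zero is the constant \<open>1\<close>, so this is the untilted
    covariance.\<close>
  have "has_bochner_integral (gauss J)
    (\<lambda>g. (\<Sum>u\<in>J. 1 * (\<Sum>v\<in>J. (c u * c v) * (g u * g v))) * tilt J (\<lambda>_. 0) g)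
    (\<Sum>u\<in>J. 1 * (\<Sum>v\<in>J. (c u * c v) * (0 * 0 + of_bool (u = v))))"
    by (intro sum_has_bochner_integral_coeff gauss_tilt_cov assms)
  moreover have "(\<Sum>v\<in>J. (c u * c v) * (0 * 0 + of_bool (u = v))) = (c u)\<^sup>2" if "u \<in> J" for u
    using assms that by (simp add: of_bool_def if_distrib power2_eq_square cong: if_cong)
  ultimately show ?thesis
    by (simp add: tilt_def power2_eq_square sum_product ac_simps)
qed

text \<open>Jensen's inequality for the power \<open>p / 2\<close> of the squared norm, which is
  compared with the tangent line of that power at its mean.\<close>

lemma gauss_norm_moment_ge:
  fixes c :: "'b \<Rightarrow> 'a \<Rightarrow> real"
  assumes J: "finite J" and p: "p \<ge> 2"
  shows "ennreal (sqrt (\<Sum>w\<in>W. \<Sum>j\<in>J. (c w j)\<^sup>2) powr p)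
    \<le> (\<integral>\<^sup>+g. ennreal (sqrt (\<Sum>w\<in>W. (\<Sum>j\<in>J. c w j * g j)\<^sup>2) powr p) \<partial>gauss J)"
proof (cases "(\<Sum>w\<in>W. \<Sum>j\<in>J. (c w j)\<^sup>2) = 0")
  case False
  define H where "H = (\<Sum>w\<in>W. \<Sum>j\<in>J. (c w j)\<^sup>2)"
  define F where "F = (\<lambda>g. \<Sum>w\<in>W. (\<Sum>j\<in>J. c w j * g j)\<^sup>2)"
  have [measurable]: "F \<in> borel_measurable (gauss J)" unfolding F_def by measurable
  have H: "H > 0" using False by (auto simp: H_def less_le sum_nonneg)
  have F: "F g \<ge> 0" for g by (simp add: F_def sum_nonneg)
  have meanF: "has_bochner_integral (gauss J) F H"
    unfolding F_def H_def by (intro has_bochner_integral_sum gauss_linear_square J)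
  have one: "has_bochner_integral (gauss J) (\<lambda>_. 1) (1 :: real)"
    using gauss_tilt_mass[OF J, of "\<lambda>_. 0"] by (simp add: tilt_def[abs_def])
  have "ennreal (H powr (p / 2)) \<le> (\<integral>\<^sup>+g. ennreal (F g powr (p / 2)) \<partial>gauss J)"
  proof (rule integral_le_nn_integral)
    let ?r = "p / 2"
    have "has_bochner_integral (gauss J) (\<lambda>g. H powr ?r * (?r / H * F g - (?r - 1) * 1)) (H powr ?r * (?r / H * H - (?r - 1) * 1))"
      by (intro has_bochner_integral_diff has_bochner_integral_mult_right meanF one)
    then show "has_bochner_integral (gauss J) (\<lambda>g. H powr ?r * (?r / H * F g - (?r - 1) * 1)) (H powr ?r)"
      using H by simp
    fix g
    \<comment> \<open>Bernoulli's inequality, obtained from Young's. For \<open>p = 2\<close> the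
      conjugate exponent would be infinite, but then both sides agree.\<close>
    have "?r / H * F g - (?r - 1) \<le> (F g / H) powr ?r"
    proof (cases "p = 2")
      case False
      define q where "q = ?r / (?r - 1)"
      have "F g / H * 1 \<le> (F g / H) powr ?r / ?r + 1 powr q / q"
        using False p H F[of g] by (intro Youngs_inequality) (auto simp: q_def field_simps)
      also have "1 powr q / q = (?r - 1) / ?r" by (simp add: q_def)
      finally have "?r * (F g / H) \<le> ?r * ((F g / H) powr ?r / ?r + (?r - 1) / ?r)"
        using p by (intro mult_left_mono) auto
      also have "\<dots> = (F g / H) powr ?r + (?r - 1)"
        using p by (simp add: distrib_left)
      finally show ?thesis by simp
    qed (use H F[of g] in simp)
    then have "H powr ?r * (?r / H * F g - (?r - 1)) \<le> H powr ?r * (F g / H) powr ?r"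
      by (rule mult_left_mono) simp
    then show "H powr ?r * (?r / H * F g - (?r - 1) * 1) \<le> F g powr ?r"
      using H F[of g] by (simp add: powr_divide)
  qed auto
  moreover have "sqrt z powr p = z powr (p / 2)" if "z \<ge> 0" for z :: real
    using that by (simp add: powr_half_sqrt[symmetric] powr_powr)
  ultimately show ?thesis
    using H F by (simp add: H_def F_def less_imp_le)
qed simp

section \<open>Multilinear forms and their fibre sums\<close>

text \<open>The expression maximised in \<open>partition_norm\<close>, with an arbitrary index set
  \<open>D\<close> in place of \<open>{1..d}\<close> so that an induction can remove
  indices.\<close>

definition form :: "nat \<Rightarrow> nat set \<Rightarrow> ((nat \<Rightarrow> nat) \<Rightarrow> real) \<Rightarrow> nat set set \<Rightarrow>
    (nat set \<Rightarrow> (nat \<Rightarrow> nat) \<Rightarrow> real) \<Rightarrow> real" where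
  "form n D A P x = (\<Sum>i\<in>multi_indices D n. A i * (\<Prod>I\<in>P. x I (restrict i I)))"

text \<open>For \<open>B\<close> outside \<open>R\<close>, the partial derivative of the form of
  \<open>insert B R\<close> in the entry \<open>w\<close> of the array of \<open>B\<close>.\<close>

definition fibre_sum :: "nat \<Rightarrow> nat set \<Rightarrow> ((nat \<Rightarrow> nat) \<Rightarrow> real) \<Rightarrow> nat set \<Rightarrow> nat set set \<Rightarrow>
    (nat set \<Rightarrow> (nat \<Rightarrow> nat) \<Rightarrow> real) \<Rightarrow> (nat \<Rightarrow> nat) \<Rightarrow> real" where
  "fibre_sum n D A B R x w =
     (\<Sum>i | i \<in> multi_indices D n \<and> restrict i B = w. A i * (\<Prod>I\<in>R. x I (restrict i I)))"

definition unit_arrays :: "nat \<Rightarrow> nat set set \<Rightarrow> (nat set \<Rightarrow> (nat \<Rightarrow> nat) \<Rightarrow> real) \<Rightarrow> bool" where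
  "unit_arrays n P x \<longleftrightarrow> (\<forall>I\<in>P. (\<Sum>u\<in>multi_indices I n. (x I u)\<^sup>2) \<le> 1)"

definition slice :: "nat \<Rightarrow> ((nat \<Rightarrow> nat) \<Rightarrow> real) \<Rightarrow> nat \<Rightarrow> (nat \<Rightarrow> nat) \<Rightarrow> real" where
  "slice a A j i = A (i(a := j))"

text \<open>The random contraction \<open>A(g)\<close>. The row \<open>a\<close> stays in the
  argument of \<open>g\<close>, so that one family of Gaussians serves all rows.\<close>

definition contract :: "nat \<Rightarrow> nat \<Rightarrow> ((nat \<Rightarrow> nat) \<Rightarrow> real) \<Rightarrow> (nat \<times> nat \<Rightarrow> real) \<Rightarrow> (nat \<Rightarrow> nat) \<Rightarrow> real" where
  "contract n a A g i = (\<Sum>j\<in>{1..n}. slice a A j i * g (a, j))"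

definition chaos :: "nat \<Rightarrow> nat set \<Rightarrow> ((nat \<Rightarrow> nat) \<Rightarrow> real) \<Rightarrow> (nat \<times> nat \<Rightarrow> real) \<Rightarrow> real" where
  "chaos n D A g = (\<Sum>i\<in>multi_indices D n. A i * (\<Prod>j\<in>D. g (j, i j)))"

lemma finite_multi_indices [simp]: "finite I \<Longrightarrow> finite (multi_indices I n)"
  by (simp add: multi_indices_def finite_PiE)

lemma restrict_multi_indices: "i \<in> multi_indices D n \<Longrightarrow> B \<subseteq> D \<Longrightarrow> restrict i B \<in> multi_indices B n"
  by (auto simp: multi_indices_def)

lemma sum_multi_indices_insert:
  assumes "a \<notin> D"
  shows "(\<Sum>i\<in>multi_indices (insert a D) n. f i) = (\<Sum>j\<in>{1..n}. \<Sum>i\<in>multi_indices D n. f (i(a := j)))"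
proof -
  have "inj_on (\<lambda>(j, i). i(a := j)) ({1..n} \<times> multi_indices D n)"
    unfolding multi_indices_def using assms by (rule inj_combinator)
  then show ?thesis
    by (simp add: multi_indices_def PiE_insert_eq sum.reindex sum.cartesian_product case_prod_unfold)
qed

lemma sum_fibres:
  fixes f h :: "(nat \<Rightarrow> nat) \<Rightarrow> real"
  assumes "finite D" "B \<subseteq> D"
  shows "(\<Sum>i\<in>multi_indices D n. f i * h (restrict i B))
    = (\<Sum>w\<in>multi_indices B n. (\<Sum>i | i \<in> multi_indices D n \<and> restrict i B = w. f i) * h w)"
proof -
  have "finite B" using assms finite_subset by blast
  then have "(\<Sum>w\<in>multi_indices B n. \<Sum>i | i \<in> multi_indices D n \<and> restrict i B = w. f i * h (restrict i B))
    = (\<Sum>i\<in>multi_indices D n. f i * h (restrict i B))"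
    using assms by (intro sum.group) (auto intro: restrict_multi_indices)
  then show ?thesis by (simp add: sum_distrib_right)
qed

lemma form_insert:
  assumes "finite D" "B \<subseteq> D" "finite R" "B \<notin> R"
  shows "form n D A (insert B R) x = (\<Sum>w\<in>multi_indices B n. fibre_sum n D A B R x w * x B w)"
proof -
  have "form n D A (insert B R) x = (\<Sum>i\<in>multi_indices D n. (A i * (\<Prod>I\<in>R. x I (restrict i I))) * x B (restrict i B))"
    unfolding form_def using assms by (intro sum.cong) auto
  also have "\<dots> = (\<Sum>w\<in>multi_indices B n. fibre_sum n D A B R x w * x B w)"
    unfolding fibre_sum_def by (rule sum_fibres[OF assms(1,2)])
  finally show ?thesis .
qed

text \<open>Setting coordinate \<open>a\<close> to \<open>j\<close> maps the fibre over
  \<open>w\<close> bijectively onto the fibre over \<open>w(a := j)\<close>, and the blocks in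
  \<open>R\<close> do not see \<open>a\<close>.\<close>

lemma fibre_sum_insert:
  assumes "a \<notin> D" "B \<subseteq> D" "\<And>I. I \<in> R \<Longrightarrow> a \<notin> I" "j \<in> {1..n}" "w \<in> multi_indices B n"
  shows "fibre_sum n (insert a D) A (insert a B) R x (w(a := j)) = fibre_sum n D (slice a A j) B R x w"
proof -
  have restr: "restrict (i(a := j)) I = restrict i I" if "a \<notin> I" for i I
    using that by (auto simp: restrict_def)
  have "a \<notin> B" using assms by auto
  then have wa: "w a = undefined" using assms(5) by (auto simp: multi_indices_def)
  have eq: "{i \<in> multi_indices (insert a D) n. restrict i (insert a B) = w(a := j)}
    = (\<lambda>i. i(a := j)) ` {i \<in> multi_indices D n. restrict i B = w}" (is "?L = ?r ` ?R")
  proof (intro equalityI subsetI)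
    fix i assume i: "i \<in> ?L"
    have "i a = j" using i by (auto simp: restrict_def fun_eq_iff split: if_splits)
    \<comment> \<open>Multi-indices are extensional, so the inverse map resets \<open>a\<close> to
      \<open>undefined\<close>.\<close>
    moreover have "i(a := undefined) \<in> multi_indices D n"
      using i assms(1) by (auto simp: multi_indices_def PiE_iff extensional_def)
    moreover have "restrict (i(a := undefined)) B = w"
    proof
      fix u show "restrict (i(a := undefined)) B u = w u"
      proof (cases "u = a")
        case False
        have "restrict i (insert a B) u = (w(a := j)) u" using i by simp
        with False show ?thesis by (auto simp: restrict_def)
      qed (use wa \<open>a \<notin> B\<close> in auto)
    qed
    ultimately show "i \<in> ?r ` ?R"
      by (intro image_eqI[of _ _ "i(a := undefined)"]) auto
  next
    fix i assume "i \<in> ?r ` ?R"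
    then obtain v where v: "v \<in> multi_indices D n" "restrict v B = w" "i = v(a := j)" by auto
    then show "i \<in> ?L"
      unfolding v(3) v(2)[symmetric] using assms(4) \<open>a \<notin> B\<close> by (auto simp: multi_indices_def PiE_iff extensional_def restrict_def fun_eq_iff)
  qed
  have "inj_on ?r ?R"
  proof (rule inj_onI)
    fix u v assume uv: "u \<in> ?R" "v \<in> ?R" "u(a := j) = v(a := j)"
    have "u a = undefined" "v a = undefined"
      using uv assms(1) by (auto simp: multi_indices_def PiE_iff extensional_def)
    with uv(3) show "u = v" by (metis fun_upd_triv fun_upd_upd)
  qed
  then show ?thesis
    unfolding fibre_sum_def eq using assms(3) by (simp add: sum.reindex slice_def restr)
qed

lemma sum_fibre_sum_squares_insert:
  assumes "a \<notin> D" "B \<subseteq> D" "\<And>I. I \<in> R \<Longrightarrow> a \<notin> I"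
  shows "(\<Sum>w\<in>multi_indices (insert a B) n. (fibre_sum n (insert a D) A (insert a B) R x w)\<^sup>2)
    = (\<Sum>j\<in>{1..n}. \<Sum>w\<in>multi_indices B n. (fibre_sum n D (slice a A j) B R x w)\<^sup>2)"
proof -
  have "a \<notin> B" using assms by auto
  then show ?thesis
    unfolding sum_multi_indices_insert[OF \<open>a \<notin> B\<close>]
    by (intro sum.cong refl) (subst fibre_sum_insert[OF assms], auto)
qed

text \<open>The equality case of Cauchy-Schwarz: the array of \<open>B\<close> becomes the
  normalised vector of fibre sums.\<close>

lemma fibre_sum_norm_attained:
  assumes "finite D" "B \<subseteq> D" "finite R" "B \<notin> R" "unit_arrays n R x"
  obtains y where "unit_arrays n (insert B R) y"
    "form n D A (insert B R) y = sqrt (\<Sum>w\<in>multi_indices B n. (fibre_sum n D A B R x w)\<^sup>2)"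
proof -
  define s where "s = sqrt (\<Sum>w\<in>multi_indices B n. (fibre_sum n D A B R x w)\<^sup>2)"
  \<comment> \<open>For \<open>s = 0\<close> division gives the zero array, which is admissible and
    attains the value \<open>0\<close>.\<close>
  define y where "y = x(B := \<lambda>w. fibre_sum n D A B R x w / s)"
  have s2: "(\<Sum>w\<in>multi_indices B n. (fibre_sum n D A B R x w)\<^sup>2) = s\<^sup>2"
    by (simp add: s_def sum_nonneg)
  have "(\<Sum>w\<in>multi_indices B n. (y B w)\<^sup>2) = s\<^sup>2 / s\<^sup>2"
    by (simp add: y_def power_divide flip: sum_divide_distrib s2)
  then have "(\<Sum>w\<in>multi_indices B n. (y B w)\<^sup>2) \<le> 1" by simp
  then have y: "unit_arrays n (insert B R) y"
    using assms(4,5) by (auto simp: unit_arrays_def y_def)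
  have "fibre_sum n D A B R y w = fibre_sum n D A B R x w" for w
    unfolding fibre_sum_def using assms(4) by (intro sum.cong arg_cong2[of _ _ _ _ "(*)"] prod.cong) (auto simp: y_def)
  then have "form n D A (insert B R) y = (\<Sum>w\<in>multi_indices B n. fibre_sum n D A B R x w * y B w)"
    using form_insert[OF assms(1-4)] by simp
  also have "\<dots> = (\<Sum>w\<in>multi_indices B n. (fibre_sum n D A B R x w)\<^sup>2) / s"
    by (simp add: y_def power2_eq_square sum_divide_distrib)
  also have "\<dots> = s"
    unfolding s2 by (simp add: power2_eq_square)
  finally show ?thesis using that y s_def by blast
qed

text \<open>Cauchy-Schwarz in the array of \<open>B\<close>. With
  \<open>fibre_sum_norm_attained\<close>, the Euclidean norm is the exact supremum over that array
  when the others are fixed.\<close>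

lemma form_insert_le:
  assumes "finite D" "B \<subseteq> D" "finite R" "B \<notin> R" "unit_arrays n (insert B R) x"
  shows "\<bar>form n D A (insert B R) x\<bar> \<le> sqrt (\<Sum>w\<in>multi_indices B n. (fibre_sum n D A B R x w)\<^sup>2)"
proof -
  have "(form n D A (insert B R) x)\<^sup>2
    \<le> (\<Sum>w\<in>multi_indices B n. (fibre_sum n D A B R x w)\<^sup>2) * (\<Sum>w\<in>multi_indices B n. (x B w)\<^sup>2)"
    unfolding form_insert[OF assms(1-4)] by (rule Cauchy_Schwarz_ineq_sum)
  also have "\<dots> \<le> (\<Sum>w\<in>multi_indices B n. (fibre_sum n D A B R x w)\<^sup>2) * 1"
    using assms(5) by (intro mult_left_mono) (auto simp: unit_arrays_def sum_nonneg)
  finally show ?thesis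
    using real_le_rsqrt by force
qed

text \<open>The indicator keeps the pairs in a common fibre, so the double sum splits into squares
  of fibre totals.\<close>

lemma sum_pairs_same_fibre:
  fixes f :: "(nat \<Rightarrow> nat) \<Rightarrow> real"
  assumes "finite D" "B \<subseteq> D"
  shows "(\<Sum>i\<in>multi_indices D n. \<Sum>k\<in>multi_indices D n. of_bool (restrict i B = restrict k B) * (f i * f k))
    = (\<Sum>w\<in>multi_indices B n. (\<Sum>i | i \<in> multi_indices D n \<and> restrict i B = w. f i)\<^sup>2)"
proof -
  define F where "F w = (\<Sum>i | i \<in> multi_indices D n \<and> restrict i B = w. f i)" for w
  have "(\<Sum>k\<in>multi_indices D n. of_bool (restrict i B = restrict k B) * (f i * f k)) = f i * F (restrict i B)" for i
  proof -
    have "(\<Sum>k\<in>multi_indices D n. of_bool (restrict i B = restrict k B) * (f i * f k))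
      = (\<Sum>k\<in>multi_indices D n. if restrict k B = restrict i B then f i * f k else 0)"
      by (intro sum.cong) auto
    also have "\<dots> = (\<Sum>k\<in>{k \<in> multi_indices D n. restrict k B = restrict i B}. f i * f k)"
      using assms(1) by (subst sum.inter_filter) auto
    finally show ?thesis by (simp add: F_def sum_distrib_left)
  qed
  then have "(\<Sum>i\<in>multi_indices D n. \<Sum>k\<in>multi_indices D n. of_bool (restrict i B = restrict k B) * (f i * f k))
    = (\<Sum>i\<in>multi_indices D n. f i * F (restrict i B))" by simp
  also have "\<dots> = (\<Sum>w\<in>multi_indices B n. F w * F w)"
    by (subst sum_fibres[OF assms]) (simp add: F_def)
  finally show ?thesis by (simp add: F_def power2_eq_square)
qed

lemma prod_of_bool: "finite S \<Longrightarrow> (\<Prod>x\<in>S. of_bool (Q x) :: real) = of_bool (\<forall>x\<in>S. Q x)"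
  by (induction S rule: finite_induct) auto

lemma restrict_Union_eq_iff: "restrict i (\<Union>S) = restrict k (\<Union>S) \<longleftrightarrow> (\<forall>I\<in>S. restrict i I = restrict k I)"
  by (auto simp: restrict_def fun_eq_iff)

text \<open>Choosing the delta exactly for the blocks in \<open>S\<close> forces \<open>i\<close>
  and \<open>k\<close> to agree on \<open>\<Union>S\<close>; the remaining factors split between
  \<open>i\<close> and \<open>k\<close>.\<close>

lemma sum_pairs_prod_expand:
  assumes D: "finite D" and P: "finite P" "\<Union>P \<subseteq> D"
  shows "(\<Sum>i\<in>multi_indices D n. \<Sum>k\<in>multi_indices D n. (A i * A k) *
      (\<Prod>I\<in>P. x I (restrict i I) * x I (restrict k I) + of_bool (restrict i I = restrict k I)))
    = (\<Sum>S\<in>Pow P. \<Sum>w\<in>multi_indices (\<Union>S) n. (fibre_sum n D A (\<Union>S) (P - S) x w)\<^sup>2)"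
proof -
  define f where "f S i = A i * (\<Prod>I\<in>P - S. x I (restrict i I))" for S i
  have "(A i * A k) * (\<Prod>I\<in>P. x I (restrict i I) * x I (restrict k I) + of_bool (restrict i I = restrict k I))
    = (\<Sum>S\<in>Pow P. of_bool (restrict i (\<Union>S) = restrict k (\<Union>S)) * (f S i * f S k))" for i k
  proof -
    have "(\<Prod>I\<in>P. x I (restrict i I) * x I (restrict k I) + of_bool (restrict i I = restrict k I))
      = (\<Prod>I\<in>P. of_bool (restrict i I = restrict k I) + x I (restrict i I) * x I (restrict k I))"
      by (simp add: add.commute)
    also have "\<dots> = (\<Sum>S\<in>Pow P. (\<Prod>I\<in>S. of_bool (restrict i I = restrict k I)) *
        (\<Prod>I\<in>P - S. x I (restrict i I) * x I (restrict k I)))"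
      by (rule prod_add[OF P(1)])
    also have "\<dots> = (\<Sum>S\<in>Pow P. of_bool (restrict i (\<Union>S) = restrict k (\<Union>S)) *
        ((\<Prod>I\<in>P - S. x I (restrict i I)) * (\<Prod>I\<in>P - S. x I (restrict k I))))"
      using P(1) by (intro sum.cong refl) (auto simp: prod_of_bool restrict_Union_eq_iff prod.distrib finite_subset)
    finally show ?thesis
      by (simp add: f_def sum_distrib_left ac_simps)
  qed
  then have "(\<Sum>i\<in>multi_indices D n. \<Sum>k\<in>multi_indices D n. (A i * A k) *
      (\<Prod>I\<in>P. x I (restrict i I) * x I (restrict k I) + of_bool (restrict i I = restrict k I)))
    = (\<Sum>i\<in>multi_indices D n. \<Sum>k\<in>multi_indices D n. \<Sum>S\<in>Pow P.
        of_bool (restrict i (\<Union>S) = restrict k (\<Union>S)) * (f S i * f S k))"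
    by simp
  also have "\<dots> = (\<Sum>i\<in>multi_indices D n. \<Sum>S\<in>Pow P. \<Sum>k\<in>multi_indices D n.
        of_bool (restrict i (\<Union>S) = restrict k (\<Union>S)) * (f S i * f S k))"
    by (intro sum.cong refl sum.swap)
  also have "\<dots> = (\<Sum>S\<in>Pow P. \<Sum>i\<in>multi_indices D n. \<Sum>k\<in>multi_indices D n.
        of_bool (restrict i (\<Union>S) = restrict k (\<Union>S)) * (f S i * f S k))"
    by (rule sum.swap)
  also have "\<dots> = (\<Sum>S\<in>Pow P. \<Sum>w\<in>multi_indices (\<Union>S) n. (fibre_sum n D A (\<Union>S) (P - S) x w)\<^sup>2)"
  proof (rule sum.cong[OF refl])
    fix S assume "S \<in> Pow P"
    then have "\<Union>S \<subseteq> D" using P(2) by auto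
    from sum_pairs_same_fibre[OF D this]
    show "(\<Sum>i\<in>multi_indices D n. \<Sum>k\<in>multi_indices D n.
        of_bool (restrict i (\<Union>S) = restrict k (\<Union>S)) * (f S i * f S k))
      = (\<Sum>w\<in>multi_indices (\<Union>S) n. (fibre_sum n D A (\<Union>S) (P - S) x w)\<^sup>2)"
      by (simp add: fibre_sum_def f_def)
  qed
  finally show ?thesis .
qed

lemma form_scale: "form n D A P (\<lambda>I u. c * x I u) = c ^ card P * form n D A P x"
  by (simp add: form_def prod.distrib sum_distrib_left ac_simps)

lemma fibre_sum_scale: "fibre_sum n D A B R (\<lambda>I u. c * x I u) w = c ^ card R * fibre_sum n D A B R x w"
  by (simp add: fibre_sum_def prod.distrib sum_distrib_left ac_simps)

lemma form_contract: "form n D (contract n a A g) P x = (\<Sum>j\<in>{1..n}. form n D (slice a A j) P x * g (a, j))"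
  unfolding form_def contract_def sum_distrib_right
  by (subst sum.swap) (simp add: ac_simps)

lemma fibre_sum_contract:
  "fibre_sum n D (contract n a A g) B R x w = (\<Sum>j\<in>{1..n}. fibre_sum n D (slice a A j) B R x w * g (a, j))"
  unfolding fibre_sum_def contract_def sum_distrib_right
  by (subst sum.swap) (simp add: ac_simps)

text \<open>For fixed values of row \<open>a\<close> the chaos is that of a matrix with one index
  less; conditioning rests on this.\<close>

lemma chaos_insert:
  assumes "finite D" "a \<notin> D"
  shows "chaos n (insert a D) A g = chaos n D (contract n a A g) g"
proof -
  have p: "(\<Prod>k\<in>D. g (k, (i(a := j)) k)) = (\<Prod>k\<in>D. g (k, i k))" for i j
    using assms(2) by (intro prod.cong) auto
  have "chaos n (insert a D) A g
    = (\<Sum>j\<in>{1..n}. \<Sum>i\<in>multi_indices D n. slice a A j i * g (a, j) * (\<Prod>k\<in>D. g (k, i k)))"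
    unfolding chaos_def sum_multi_indices_insert[OF assms(2)]
    using assms by (simp add: p slice_def fun_upd_same ac_simps del: fun_upd_apply)
  then show ?thesis
    unfolding chaos_def contract_def sum_distrib_right by (subst (asm) sum.swap) simp
qed

lemma chaos_cong:
  assumes "\<And>i. i \<in> multi_indices D n \<Longrightarrow> A i = A' i" "\<And>k j. k \<in> D \<Longrightarrow> j \<in> {1..n} \<Longrightarrow> g (k, j) = g' (k, j)"
  shows "chaos n D A g = chaos n D A' g'"
  unfolding chaos_def using assms
  by (intro sum.cong arg_cong2[of _ _ _ _ "(*)"] prod.cong refl) (auto simp: multi_indices_def PiE_iff Pi_iff)

section \<open>Smoothing by Gaussian arrays\<close>

text \<open>A nested product: one independent Gaussian array per block, so that tilts factorise over
  the blocks.\<close>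

definition arrays_gauss :: "nat \<Rightarrow> nat set set \<Rightarrow> (nat set \<Rightarrow> (nat \<Rightarrow> nat) \<Rightarrow> real) measure" where
  "arrays_gauss n P = Pi\<^sub>M P (\<lambda>I. gauss (multi_indices I n))"

definition arrays_tilt ::
    "nat \<Rightarrow> nat set set \<Rightarrow> (nat set \<Rightarrow> (nat \<Rightarrow> nat) \<Rightarrow> real) \<Rightarrow> (nat set \<Rightarrow> (nat \<Rightarrow> nat) \<Rightarrow> real) \<Rightarrow> real" where
  "arrays_tilt n P x \<theta> = (\<Prod>I\<in>P. tilt (multi_indices I n) (x I) (\<theta> I))"

lemma prob_space_arrays_gauss: "prob_space (arrays_gauss n P)"
  unfolding arrays_gauss_def by (intro prob_space_PiM prob_space_gauss)

lemma measurable_arrays_coord: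
  assumes "I \<in> P" "u \<in> multi_indices I n"
  shows "(\<lambda>\<theta>. \<theta> I u) \<in> borel_measurable (arrays_gauss n P)"
proof -
  have "(\<lambda>\<theta>. \<theta> I) \<in> measurable (arrays_gauss n P) (gauss (multi_indices I n))"
    unfolding arrays_gauss_def by (rule measurable_component_singleton[OF assms(1)])
  from measurable_compose[OF this measurable_coord[OF assms(2)]] show ?thesis .
qed

lemma measurable_form:
  assumes "\<And>I. I \<in> P \<Longrightarrow> I \<subseteq> D"
  shows "form n D A P \<in> borel_measurable (arrays_gauss n P)"
  unfolding form_def
  by (intro borel_measurable_sum borel_measurable_times borel_measurable_const borel_measurable_prod
      measurable_arrays_coord restrict_multi_indices) (auto dest: assms)

lemma arrays_tilt_pos: "0 < arrays_tilt n P x \<theta>"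
  by (simp add: arrays_tilt_def prod_pos tilt_pos)

lemma arrays_tilt_eq:
  assumes "finite P"
  shows "arrays_tilt n P x \<theta> = exp ((\<Sum>I\<in>P. \<Sum>u\<in>multi_indices I n. x I u * \<theta> I u)
      - (\<Sum>I\<in>P. \<Sum>u\<in>multi_indices I n. (x I u)\<^sup>2) / 2)"
  using assms by (simp add: arrays_tilt_def tilt_def sum_subtractf sum_divide_distrib flip: exp_sum)

context
  fixes n :: nat and P :: "nat set set"
  assumes fin: "finite P" "\<And>I. I \<in> P \<Longrightarrow> finite I"
begin

lemma arrays_tilt_prod_integral:
  assumes "\<And>I. I \<in> P \<Longrightarrow>
    has_bochner_integral (gauss (multi_indices I n)) (\<lambda>g. f I g * tilt (multi_indices I n) (x I) g) (m I)"
  shows "has_bochner_integral (arrays_gauss n P) (\<lambda>\<theta>. (\<Prod>I\<in>P. f I (\<theta> I)) * arrays_tilt n P x \<theta>) (\<Prod>I\<in>P. m I)"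
  using has_bochner_integral_PiM_prod[OF product_sigma_finite_gauss_family fin(1),
      where f = "\<lambda>I g. f I g * tilt (multi_indices I n) (x I) g", OF assms]
  by (simp add: arrays_gauss_def arrays_tilt_def prod.distrib)

lemma arrays_tilt_mass: "has_bochner_integral (arrays_gauss n P) (arrays_tilt n P x) 1"
proof -
  have "has_bochner_integral (arrays_gauss n P) (\<lambda>\<theta>. (\<Prod>I\<in>P. 1) * arrays_tilt n P x \<theta>) (\<Prod>I\<in>P. 1)"
    using fin by (intro arrays_tilt_prod_integral) (simp add: gauss_tilt_mass)
  then show ?thesis by simp
qed

text \<open>The logarithm of the tilt is this inner product minus half the squared length of
  \<open>x\<close>, so its mean gives the relative entropy of the shift.\<close>

lemma arrays_tilt_inner:
  "has_bochner_integral (arrays_gauss n P)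
    (\<lambda>\<theta>. (\<Sum>I\<in>P. \<Sum>u\<in>multi_indices I n. x I u * \<theta> I u) * arrays_tilt n P x \<theta>)
    (\<Sum>I\<in>P. \<Sum>u\<in>multi_indices I n. (x I u)\<^sup>2)"
proof -
  have 1: "has_bochner_integral (arrays_gauss n P) (\<lambda>\<theta>. \<theta> I u * arrays_tilt n P x \<theta>) (x I u)"
    if "I \<in> P" "u \<in> multi_indices I n" for I u
  proof -
    have "has_bochner_integral (arrays_gauss n P)
      (\<lambda>\<theta>. (\<Prod>I'\<in>P. if I' = I then \<theta> I' u else 1) * arrays_tilt n P x \<theta>) (\<Prod>I'\<in>P. if I' = I then x I' u else 1)"
    proof (rule arrays_tilt_prod_integral)
      fix I' assume I': "I' \<in> P"
      have "finite (multi_indices I' n)" using fin I' by simp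
      then show "has_bochner_integral (gauss (multi_indices I' n))
          (\<lambda>g. (if I' = I then g u else 1) * tilt (multi_indices I' n) (x I') g) (if I' = I then x I' u else 1)"
        using that(2) by (cases "I' = I") (simp_all add: gauss_tilt_mass gauss_tilt_mean)
    qed
    then show ?thesis using that(1) fin(1) by simp
  qed
  have "has_bochner_integral (arrays_gauss n P)
    (\<lambda>\<theta>. (\<Sum>I\<in>P. 1 * (\<Sum>u\<in>multi_indices I n. x I u * \<theta> I u)) * arrays_tilt n P x \<theta>)
    (\<Sum>I\<in>P. 1 * (\<Sum>u\<in>multi_indices I n. x I u * x I u))"
    by (intro sum_has_bochner_integral_coeff 1)
  then show ?thesis by (simp add: power2_eq_square)
qed

context
  fixes D :: "nat set"
  assumes D: "finite D" "\<And>I. I \<in> P \<Longrightarrow> I \<subseteq> D"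
begin

text \<open>Every monomial uses each block once, and the blocks are independent with means
  \<open>x\<close>, so the mean of the form is its value at \<open>x\<close>.\<close>

lemma arrays_tilt_form:
  "has_bochner_integral (arrays_gauss n P) (\<lambda>\<theta>. form n D A P \<theta> * arrays_tilt n P x \<theta>) (form n D A P x)"
  unfolding form_def
  by (intro sum_has_bochner_integral_coeff arrays_tilt_prod_integral gauss_tilt_mean
      finite_multi_indices fin restrict_multi_indices D(1)) (auto dest: D(2))

text \<open>Tilting shifts the Gaussian arrays by \<open>x\<close>, so each pair of factors contributes
  \<open>x x\<close> plus a Kronecker delta, and every choice of deltas glues the blocks in \<open>S\<close> together.\<close>
lemma arrays_tilt_form_square:
  "has_bochner_integral (arrays_gauss n P) (\<lambda>\<theta>. (form n D A P \<theta>)\<^sup>2 * arrays_tilt n P x \<theta>)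
    (\<Sum>S\<in>Pow P. \<Sum>w\<in>multi_indices (\<Union>S) n. (fibre_sum n D A (\<Union>S) (P - S) x w)\<^sup>2)"
proof -
  have "has_bochner_integral (arrays_gauss n P)
    (\<lambda>\<theta>. (\<Sum>i\<in>multi_indices D n. 1 * (\<Sum>k\<in>multi_indices D n. (A i * A k) *
        (\<Prod>I\<in>P. \<theta> I (restrict i I) * \<theta> I (restrict k I)))) * arrays_tilt n P x \<theta>)
    (\<Sum>i\<in>multi_indices D n. 1 * (\<Sum>k\<in>multi_indices D n. (A i * A k) *
        (\<Prod>I\<in>P. x I (restrict i I) * x I (restrict k I) + of_bool (restrict i I = restrict k I))))"
    by (intro sum_has_bochner_integral_coeff arrays_tilt_prod_integral gauss_tilt_cov
        finite_multi_indices fin restrict_multi_indices D(1)) (auto dest: D(2))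
  moreover have "(\<Sum>i\<in>multi_indices D n. 1 * (\<Sum>k\<in>multi_indices D n. (A i * A k) *
        (\<Prod>I\<in>P. \<theta> I (restrict i I) * \<theta> I (restrict k I)))) = (form n D A P \<theta>)\<^sup>2" for \<theta>
    by (simp add: form_def power2_eq_square sum_product prod.distrib ac_simps)
  ultimately show ?thesis
    using D by (simp add: sum_pairs_prod_expand fin(1) Sup_le_iff)
qed

end

end

text \<open>\<open>S\<close> is the set of blocks of \<open>P\<close> that are merged with the new index \<open>a\<close> into one block.\<close>
definition contracted_energy where
  "contracted_energy n a D A P x = (\<Sum>S\<in>Pow P. \<Sum>w\<in>multi_indices (insert a (\<Union>S)) n.
     (fibre_sum n (insert a D) A (insert a (\<Union>S)) (P - S) x w)\<^sup>2)"

text \<open>For fixed \<open>\<theta>\<close> the form of the contraction is a centred Gaussian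
  variable in \<open>g\<close> whose variance is the sum over \<open>j\<close>; the subtracted term
  normalises its exponential moment to \<open>1\<close>.\<close>

definition gibbs_weight where
  "gibbs_weight n a D A P c g \<theta> = exp (c * form n D (contract n a A g) P \<theta>
     - c\<^sup>2 / 2 * (\<Sum>j\<in>{1..n}. (form n D (slice a A j) P \<theta>)\<^sup>2))"

text \<open>The random variable \<open>Z(g)\<close> of the opening argument; it does not involve the
  arrays at which the form is to be bounded.\<close>

definition partition_function where
  "partition_function n a D A P c g = (\<integral>\<^sup>+\<theta>. ennreal (gibbs_weight n a D A P c g \<theta>) \<partial>arrays_gauss n P)"

lemma gibbs_weight_tilt:
  "gibbs_weight n a D A P c g \<theta> = tilt ({a} \<times> {1..n}) (\<lambda>v. c * form n D (slice a A (snd v)) P \<theta>) g"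
  by (simp add: sum.cartesian_product' gibbs_weight_def tilt_def form_contract sum_distrib_left
      sum_subtractf power_mult_distrib ac_simps)

context
  fixes n a :: nat and D :: "nat set" and P :: "nat set set" and A :: "(nat \<Rightarrow> nat) \<Rightarrow> real"
  assumes D: "finite D" "a \<notin> D" and P: "partition_on D P"
begin

lemma partition_blocks: "finite P" "\<And>I. I \<in> P \<Longrightarrow> finite I" "\<And>I. I \<in> P \<Longrightarrow> I \<subseteq> D" "\<Union>P = D" "\<And>I. I \<in> P \<Longrightarrow> a \<notin> I"
proof -
  show *: "I \<in> P \<Longrightarrow> I \<subseteq> D" for I using P by (auto simp: partition_on_def)
  show "I \<in> P \<Longrightarrow> finite I" for I using * D(1) finite_subset by blast
  show "I \<in> P \<Longrightarrow> a \<notin> I" for I using * D(2) by blast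
  show "finite P" by (rule finite_elements[OF D(1) P])
  show "\<Union>P = D" using P by (simp add: partition_on_def)
qed

lemma measurable_gibbs_weight:
  "(\<lambda>(g, \<theta>). gibbs_weight n a D A P c g \<theta>) \<in> borel_measurable (gauss ({a} \<times> {1..n}) \<Otimes>\<^sub>M arrays_gauss n P)"
proof -
  have F: "(\<lambda>x. form n D A' P (snd x)) \<in> borel_measurable (gauss ({a} \<times> {1..n}) \<Otimes>\<^sub>M arrays_gauss n P)" for A'
    by (rule measurable_compose[OF measurable_snd measurable_form]) (rule partition_blocks)
  have G: "(\<lambda>x. fst x (a, j)) \<in> borel_measurable (gauss ({a} \<times> {1..n}) \<Otimes>\<^sub>M arrays_gauss n P)"
    if "j \<in> {1..n}" for j
    by (rule measurable_compose[OF measurable_fst measurable_coord]) (use that in simp)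
  show ?thesis
    unfolding gibbs_weight_def case_prod_unfold form_contract
    by (rule measurable_compose[OF _ borel_measurable_exp])
      (intro borel_measurable_diff borel_measurable_times borel_measurable_sum
        borel_measurable_power borel_measurable_const F G)
qed

lemma measurable_partition_function:
  "partition_function n a D A P c \<in> borel_measurable (gauss ({a} \<times> {1..n}))"
proof -
  interpret sigma_finite_measure "arrays_gauss n P"
    using prob_space_arrays_gauss by (rule prob_space_imp_sigma_finite)
  show ?thesis
    unfolding partition_function_def[abs_def]
    using measurable_gibbs_weight by (intro borel_measurable_nn_integral) (simp add: case_prod_unfold)
qed

text \<open>By Tonelli \<open>g\<close> is integrated first, and for fixed \<open>\<theta>\<close>
  the integrand is a tilt of mass \<open>1\<close>.\<close>

lemma nn_integral_partition_function:
  "(\<integral>\<^sup>+g. partition_function n a D A P c g \<partial>gauss ({a} \<times> {1..n})) = 1"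
proof -
  interpret \<Gamma>: prob_space "gauss ({a} \<times> {1..n})" by (rule prob_space_gauss)
  interpret \<Theta>: prob_space "arrays_gauss n P" by (rule prob_space_arrays_gauss)
  interpret pair_sigma_finite "gauss ({a} \<times> {1..n})" "arrays_gauss n P" ..
  have "(\<integral>\<^sup>+g. partition_function n a D A P c g \<partial>gauss ({a} \<times> {1..n}))
    = (\<integral>\<^sup>+\<theta>. (\<integral>\<^sup>+g. ennreal (gibbs_weight n a D A P c g \<theta>) \<partial>gauss ({a} \<times> {1..n})) \<partial>arrays_gauss n P)"
    unfolding partition_function_def
    using measurable_gibbs_weight by (intro Fubini'[symmetric]) (simp add: case_prod_unfold)
  also have "\<dots> = 1"
    by (simp add: gibbs_weight_tilt nn_integral_tilt \<Theta>.emeasure_space_1)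
  finally show ?thesis .
qed

text \<open>The Gibbs variational argument: the integral over \<open>\<theta>\<close> is rewritten
  under the law shifted by \<open>x\<close>, and Jensen's inequality applies. One partition function
  serves all \<open>x\<close>, so the supremum over \<open>x\<close> comes for free.\<close>

lemma exp_form_le_partition_function:
  "ennreal (exp (c * form n D (contract n a A g) P x))
    \<le> ennreal (exp (c\<^sup>2 / 2 * contracted_energy n a D A P x + (\<Sum>I\<in>P. \<Sum>u\<in>multi_indices I n. (x I u)\<^sup>2) / 2))
      * partition_function n a D A P c g"
proof -
  let ?N = "\<Sum>I\<in>P. \<Sum>u\<in>multi_indices I n. (x I u)\<^sup>2"
  let ?W = "arrays_tilt n P x"
  let ?ip = "\<lambda>\<theta>. \<Sum>I\<in>P. \<Sum>u\<in>multi_indices I n. x I u * \<theta> I u"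
  let ?Q = "\<lambda>\<theta>. \<Sum>j\<in>{1..n}. (form n D (slice a A j) P \<theta>)\<^sup>2"
  \<comment> \<open>The logarithm of the Gibbs weight minus the logarithm of the tilt by
    \<open>x\<close>.\<close>
  define Y where "Y = (\<lambda>\<theta>. c * form n D (contract n a A g) P \<theta> - c\<^sup>2 / 2 * ?Q \<theta> - (?ip \<theta> - ?N / 2))"
  note F = partition_blocks(1,2)
  note F' = F D(1) partition_blocks(3)
  have q: "has_bochner_integral (arrays_gauss n P) (\<lambda>\<theta>. (\<Sum>j\<in>{1..n}. 1 * (form n D (slice a A j) P \<theta>)\<^sup>2) * ?W \<theta>)
    (\<Sum>j\<in>{1..n}. 1 * (\<Sum>S\<in>Pow P. \<Sum>w\<in>multi_indices (\<Union>S) n. (fibre_sum n D (slice a A j) (\<Union>S) (P - S) x w)\<^sup>2))"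
    by (intro sum_has_bochner_integral_coeff arrays_tilt_form_square F')
  have "(\<Sum>j\<in>{1..n}. 1 * (\<Sum>S\<in>Pow P. \<Sum>w\<in>multi_indices (\<Union>S) n. (fibre_sum n D (slice a A j) (\<Union>S) (P - S) x w)\<^sup>2))
    = (\<Sum>S\<in>Pow P. \<Sum>j\<in>{1..n}. \<Sum>w\<in>multi_indices (\<Union>S) n. (fibre_sum n D (slice a A j) (\<Union>S) (P - S) x w)\<^sup>2)"
    by (simp add: sum.swap[of _ "Pow P"])
  \<comment> \<open>Summing over \<open>j\<close> absorbs the index \<open>a\<close> into the merged
    block.\<close>
  also have "\<dots> = contracted_energy n a D A P x"
    unfolding contracted_energy_def
    using partition_blocks D by (intro sum.cong refl sum_fibre_sum_squares_insert[symmetric]) auto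
  finally have energy: "has_bochner_integral (arrays_gauss n P) (\<lambda>\<theta>. ?Q \<theta> * ?W \<theta>) (contracted_energy n a D A P x)"
    using q by simp
  have "has_bochner_integral (arrays_gauss n P)
    (\<lambda>\<theta>. c * (form n D (contract n a A g) P \<theta> * ?W \<theta>) - c\<^sup>2 / 2 * (?Q \<theta> * ?W \<theta>) - (?ip \<theta> * ?W \<theta> - ?N / 2 * ?W \<theta>))
    (c * form n D (contract n a A g) P x - c\<^sup>2 / 2 * contracted_energy n a D A P x - (?N - ?N / 2 * 1))"
    by (intro has_bochner_integral_diff has_bochner_integral_mult_right energy
        arrays_tilt_form arrays_tilt_inner arrays_tilt_mass F')
  then have Y: "has_bochner_integral (arrays_gauss n P) (\<lambda>\<theta>. Y \<theta> * ?W \<theta>)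
    (c * form n D (contract n a A g) P x - c\<^sup>2 / 2 * contracted_energy n a D A P x - ?N / 2)"
    by (simp add: Y_def algebra_simps)
  have Y_meas: "Y \<in> borel_measurable (arrays_gauss n P)"
    unfolding Y_def
    by (intro borel_measurable_diff borel_measurable_times borel_measurable_sum borel_measurable_power
        borel_measurable_const measurable_form measurable_arrays_coord partition_blocks(3))
  have "exp (Y \<theta>) * ?W \<theta> = gibbs_weight n a D A P c g \<theta>" for \<theta>
    by (simp add: Y_def gibbs_weight_def arrays_tilt_eq[OF F(1)] flip: exp_add)
  then have "ennreal (exp (c * form n D (contract n a A g) P x - c\<^sup>2 / 2 * contracted_energy n a D A P x - ?N / 2))
    \<le> partition_function n a D A P c g"
    using exp_integral_le_nn_integral[OF arrays_tilt_mass[OF F] _ Y Y_meas] arrays_tilt_pos[of n P x]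
    by (simp add: partition_function_def less_imp_le)
  then have "ennreal (exp (c\<^sup>2 / 2 * contracted_energy n a D A P x + ?N / 2))
     * ennreal (exp (c * form n D (contract n a A g) P x - c\<^sup>2 / 2 * contracted_energy n a D A P x - ?N / 2))
    \<le> ennreal (exp (c\<^sup>2 / 2 * contracted_energy n a D A P x + ?N / 2)) * partition_function n a D A P c g"
    by (rule mult_left_mono) simp
  then show ?thesis
    by (simp flip: ennreal_mult' exp_add)
qed

text \<open>For each \<open>S\<close> the merged block and the untouched blocks partition
  \<open>insert a D\<close>, and the norm of the fibre sums is attained by a form. Scaling yields
  \<open>p ^ card (P - S)\<close>, while the squared hypothesis has one more factor \<open>p\<close>
  for the merged block, hence \<open>s\<^sup>2 / p\<close>.\<close>

lemma contracted_energy_le: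
  fixes p s :: real
  assumes p: "p > 0" and s: "s \<ge> 0"
    and bound: "\<And>Q y. partition_on (insert a D) Q \<Longrightarrow> unit_arrays n Q y \<Longrightarrow>
      sqrt p ^ card Q * \<bar>form n (insert a D) A Q y\<bar> \<le> s"
    and y: "unit_arrays n P y"
  shows "contracted_energy n a D A P (\<lambda>I u. sqrt p * y I u) \<le> 2 ^ card P * (s\<^sup>2 / p)"
proof -
  have "(\<Sum>w\<in>multi_indices (insert a (\<Union>S)) n.
     (fibre_sum n (insert a D) A (insert a (\<Union>S)) (P - S) (\<lambda>I u. sqrt p * y I u) w)\<^sup>2) \<le> s\<^sup>2 / p"
    if S: "S \<in> Pow P" for S
  proof -
    let ?B = "insert a (\<Union>S)" and ?R = "P - S"
    let ?T = "\<Sum>w\<in>multi_indices ?B n. (fibre_sum n (insert a D) A ?B ?R y w)\<^sup>2"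
    have notin: "?B \<notin> ?R" using partition_blocks(5) by auto
    have PP: "I \<inter> I' = {}" if "I \<in> P" "I' \<in> P" "I \<noteq> I'" for I I'
      using partition_onD2[OF P] that by (auto dest: disjointD)
    have BR: "?B \<inter> I = {}" if I: "I \<in> ?R" for I
    proof -
      have "I' \<inter> I = {}" if "I' \<in> S" for I' using PP[of I' I] I S that by auto
      moreover have "a \<notin> I" using partition_blocks(5) I by auto
      ultimately show ?thesis by auto
    qed
    have "partition_on (insert a D) (insert ?B ?R)"
    proof (rule partition_onI)
      show "disjnt I I'" if "I \<in> insert ?B ?R" "I' \<in> insert ?B ?R" "I \<noteq> I'" for I I'
        using that PP BR unfolding disjnt_def by (metis DiffD1 Int_commute insert_iff)
    qed (use S P partition_blocks(4) in \<open>auto simp: partition_on_def\<close>)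
    moreover obtain z where z: "unit_arrays n (insert ?B ?R) z" "form n (insert a D) A (insert ?B ?R) z = sqrt ?T"
    proof -
      have "?B \<subseteq> insert a D" using S partition_blocks(3) by blast
      moreover have "finite (insert a D)" "finite ?R" using D(1) partition_blocks(1) by simp_all
      moreover have "unit_arrays n ?R y" using y by (simp add: unit_arrays_def)
      ultimately have "?B \<subseteq> insert a D" "finite (insert a D)" "finite ?R" "unit_arrays n ?R y" by simp_all
      from fibre_sum_norm_attained[OF this(2,1,3) notin this(4)] that show ?thesis by blast
    qed
    ultimately have "sqrt p ^ card (insert ?B ?R) * sqrt ?T \<le> s"
      using bound[of "insert ?B ?R" z] by (simp add: sum_nonneg)
    then have "(sqrt p ^ Suc (card ?R) * sqrt ?T)\<^sup>2 \<le> s\<^sup>2"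
      using notin partition_blocks(1) p by (intro power_mono) (auto simp: sum_nonneg)
    also have "(sqrt p ^ Suc (card ?R) * sqrt ?T)\<^sup>2 = p * (p ^ card ?R * ?T)"
      using p by (simp add: power_mult_distrib sum_nonneg flip: power_mult) (simp add: power_mult mult.commute)
    finally have "p ^ card ?R * ?T \<le> s\<^sup>2 / p"
      using p by (simp add: field_simps)
    then show ?thesis
      using p by (simp add: fibre_sum_scale power_mult_distrib sum_distrib_left flip: power_mult)
         (simp add: power_mult mult.commute)
  qed
  then have "contracted_energy n a D A P (\<lambda>I u. sqrt p * y I u) \<le> (\<Sum>S\<in>Pow P. s\<^sup>2 / p)"
    unfolding contracted_energy_def by (rule sum_mono)
  then show ?thesis
    using partition_blocks(1) by (simp add: card_Pow)
qed

text \<open>With \<open>c\<close> equal to \<open>p / s\<close> or \<open>- p / s\<close> and arrays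
  \<open>sqrt p * y\<close>, energy and entropy each cost at most \<open>p * 2 ^ card P / 2\<close>
  in the exponent. The two signs of \<open>c\<close> cover those of the form.\<close>

lemma form_contract_powr_le:
  fixes p s :: real
  assumes p: "p > 0" and s: "s > 0"
    and bound: "\<And>Q y. partition_on (insert a D) Q \<Longrightarrow> unit_arrays n Q y \<Longrightarrow>
      sqrt p ^ card Q * \<bar>form n (insert a D) A Q y\<bar> \<le> s"
    and y: "unit_arrays n P y"
  shows "ennreal ((sqrt p ^ card P * \<bar>form n D (contract n a A g) P y\<bar>) powr p)
    \<le> ennreal ((exp (2 ^ card P) * s) powr p)
       * (partition_function n a D A P (p / s) g + partition_function n a D A P (- p / s) g)"
proof -
  define x where "x = (\<lambda>I u. sqrt p * y I u)"
  define t where "t = form n D (contract n a A g) P x"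
  have t: "t = sqrt p ^ card P * form n D (contract n a A g) P y"
    by (simp add: t_def x_def form_scale)
  have E: "contracted_energy n a D A P x \<le> 2 ^ card P * (s\<^sup>2 / p)"
    unfolding x_def using assms by (intro contracted_energy_le) auto
  have N: "(\<Sum>I\<in>P. \<Sum>u\<in>multi_indices I n. (x I u)\<^sup>2) \<le> p * card P"
  proof -
    have "(\<Sum>u\<in>multi_indices I n. (x I u)\<^sup>2) \<le> p" if "I \<in> P" for I
    proof -
      have "(\<Sum>u\<in>multi_indices I n. (x I u)\<^sup>2) = p * (\<Sum>u\<in>multi_indices I n. (y I u)\<^sup>2)"
        using p by (simp add: x_def power_mult_distrib sum_distrib_left)
      also have "\<dots> \<le> p * 1"
        using y that p by (intro mult_left_mono) (auto simp: unit_arrays_def)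
      finally show ?thesis by simp
    qed
    from sum_mono[of P, OF this] show ?thesis by (simp add: mult.commute)
  qed
  have "card P \<le> (2::real) ^ card P"
    using of_nat_mono[OF less_imp_le[OF less_exp[of "card P"]], where 'a = real] by simp
  then have N': "(\<Sum>I\<in>P. \<Sum>u\<in>multi_indices I n. (x I u)\<^sup>2) \<le> p * 2 ^ card P"
    using N p by (meson mult_left_mono less_imp_le order_trans)
  have main: "ennreal (exp (c * t)) \<le> ennreal (exp (p * 2 ^ card P)) * partition_function n a D A P c g"
    if "c\<^sup>2 = (p / s)\<^sup>2" for c
  proof -
    have "c\<^sup>2 / 2 * contracted_energy n a D A P x \<le> c\<^sup>2 / 2 * (2 ^ card P * (s\<^sup>2 / p))"
      by (intro mult_left_mono E) simp
    also have "\<dots> = p * 2 ^ card P / 2"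
      unfolding that using p s by (simp add: field_simps power2_eq_square)
    finally have "c\<^sup>2 / 2 * contracted_energy n a D A P x + (\<Sum>I\<in>P. \<Sum>u\<in>multi_indices I n. (x I u)\<^sup>2) / 2 \<le> p * 2 ^ card P"
      using N' by simp
    then show ?thesis
      unfolding t_def by (intro order_trans[OF exp_form_le_partition_function] mult_right_mono ennreal_leI) auto
  qed
  let ?V = "partition_function n a D A P (p / s) g + partition_function n a D A P (- p / s) g"
  \<comment> \<open>\<open>u \<le> exp u\<close> replaces the power by an exponential with parameter
    \<open>p / s\<close>.\<close>
  have "(\<bar>t\<bar> / s) powr p \<le> exp (\<bar>t\<bar> / s) powr p"
    using s p by (intro powr_mono2) (auto intro: order_trans[OF _ exp_ge_add_one_self])
  also have "\<dots> = exp (p / s * \<bar>t\<bar>)"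
    by (simp add: powr_def mult.commute)
  finally have "ennreal ((\<bar>t\<bar> / s) powr p) \<le> ennreal (exp (p / s * \<bar>t\<bar>))"
    by (rule ennreal_leI)
  also have "\<dots> \<le> ennreal (exp (p * 2 ^ card P)) * ?V"
  proof (cases "t \<ge> 0")
    case True
    then show ?thesis using main[of "p / s"] by (simp add: distrib_left add_increasing2)
  next
    case False
    then show ?thesis using main[of "- p / s"] by (simp add: distrib_left add_increasing)
  qed
  finally have "ennreal (s powr p) * ennreal ((\<bar>t\<bar> / s) powr p)
      \<le> ennreal (s powr p) * (ennreal (exp (p * 2 ^ card P)) * ?V)"
    by (rule mult_left_mono) simp
  moreover have "ennreal (s powr p) * ennreal ((\<bar>t\<bar> / s) powr p) = ennreal (\<bar>t\<bar> powr p)"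
    using s by (simp add: powr_divide flip: ennreal_mult')
  moreover have "ennreal (s powr p) * (ennreal (exp (p * 2 ^ card P)) * ?V) = ennreal ((exp (2 ^ card P) * s) powr p) * ?V"
    using s by (simp add: powr_mult exp_powr_real mult.assoc[symmetric] mult.commute flip: ennreal_mult')
  ultimately show ?thesis
    using p by (simp add: t abs_mult)
qed

end

section \<open>Moments by conditioning on one row\<close>

text \<open>An extended nonnegative integral, so that Tonelli applies before finiteness is
  known.\<close>

definition chaos_moment :: "nat \<Rightarrow> nat set \<Rightarrow> ((nat \<Rightarrow> nat) \<Rightarrow> real) \<Rightarrow> real \<Rightarrow> ennreal" where
  "chaos_moment n D A p = (\<integral>\<^sup>+g. ennreal (\<bar>chaos n D A g\<bar> powr p) \<partial>gauss (D \<times> {1..n}))"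

lemma measurable_chaos: "chaos n D A \<in> borel_measurable (gauss (D \<times> {1..n}))"
  unfolding chaos_def
  by (intro borel_measurable_sum borel_measurable_times borel_measurable_const borel_measurable_prod measurable_coord)
    (auto simp: multi_indices_def)

lemma chaos_moment_empty:
  "chaos_moment n {} A p = ennreal (\<bar>form n {} A {} x\<bar> powr p)"
proof -
  interpret prob_space "gauss ({} :: (nat \<times> nat) set)" by (rule prob_space_gauss)
  show ?thesis
    by (simp add: chaos_moment_def chaos_def form_def emeasure_space_1)
qed

text \<open>The rows are independent, so row \<open>a\<close> can be integrated last; the inner
  integral is the moment for the contraction.\<close>

lemma chaos_moment_insert:
  assumes "finite D" "a \<notin> D"
  shows "chaos_moment n (insert a D) A p
    = (\<integral>\<^sup>+g. chaos_moment n D (contract n a A g) p \<partial>gauss ({a} \<times> {1..n}))"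
proof -
  interpret product_sigma_finite "\<lambda>_ :: nat \<times> nat. std_gauss" by (rule product_sigma_finite_gauss)
  have un: "insert a D \<times> {1..n} = {a} \<times> {1..n} \<union> D \<times> {1..n}" by auto
  have disj: "({a} \<times> {1..n}) \<inter> (D \<times> {1..n}) = {}" using assms by auto
  have "(\<lambda>g. ennreal (\<bar>chaos n (insert a D) A g\<bar> powr p)) \<in> borel_measurable (gauss (insert a D \<times> {1..n}))"
    using measurable_chaos[of n "insert a D" A] by measurable
  then have "chaos_moment n (insert a D) A p
    = (\<integral>\<^sup>+x. (\<integral>\<^sup>+y. ennreal (\<bar>chaos n (insert a D) A (merge ({a} \<times> {1..n}) (D \<times> {1..n}) (x, y))\<bar> powr p)
        \<partial>gauss (D \<times> {1..n})) \<partial>gauss ({a} \<times> {1..n}))"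
    unfolding chaos_moment_def un gauss_def using assms disj by (intro product_nn_integral_fold) auto
  moreover have "chaos n (insert a D) A (merge ({a} \<times> {1..n}) (D \<times> {1..n}) (x, y)) = chaos n D (contract n a A x) y" for x y
    unfolding chaos_insert[OF assms]
    by (rule chaos_cong) (use assms in \<open>auto simp: contract_def merge_def intro!: sum.cong\<close>)
  ultimately show ?thesis
    by (simp add: chaos_moment_def)
qed

text \<open>The hypothesis is a bound \<open>s\<close> on all weighted forms, so the induction
  hypothesis can be applied to the contraction with a bound depending on \<open>g\<close>.\<close>

lemma chaos_moment_upper:
  assumes "finite D"
  shows "\<exists>C>0. \<forall>n A p s. p \<ge> 2 \<longrightarrow> s > 0 \<longrightarrow>
    (\<forall>Q y. partition_on D Q \<longrightarrow> unit_arrays n Q y \<longrightarrow> sqrt p ^ card Q * \<bar>form n D A Q y\<bar> \<le> s) \<longrightarrow>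
    chaos_moment n D A p \<le> ennreal ((C * s) powr p)"
  using assms
proof (induction D rule: finite_induct)
  case empty
  have "chaos_moment n {} A p \<le> ennreal ((1 * s) powr p)"
    if "p \<ge> 2" "s > 0" "\<forall>Q y. partition_on {} Q \<longrightarrow> unit_arrays n Q y \<longrightarrow> sqrt p ^ card Q * \<bar>form n {} A Q y\<bar> \<le> s"
    for n A p s
  proof -
    have "\<bar>form n {} A {} (\<lambda>_ _. 0)\<bar> \<le> s"
      using that(3)[rule_format, of "{}" "\<lambda>_ _. 0"] by (simp add: partition_on_empty unit_arrays_def)
    then show ?thesis
      using that(1) by (simp add: chaos_moment_empty[of _ _ _ "\<lambda>_ _. 0"] ennreal_leI powr_mono2)
  qed
  then show ?case by (metis zero_less_one)
next
  case (insert a D)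
  then obtain C where C: "C > 0"
    and IH: "\<And>n A p s. p \<ge> 2 \<Longrightarrow> s > 0 \<Longrightarrow>
    (\<And>Q y. partition_on D Q \<Longrightarrow> unit_arrays n Q y \<Longrightarrow> sqrt p ^ card Q * \<bar>form n D A Q y\<bar> \<le> s) \<Longrightarrow>
    chaos_moment n D A p \<le> ennreal ((C * s) powr p)"
    by metis
  define Ps where "Ps = {P. partition_on D P}"
  have Ps: "finite Ps" unfolding Ps_def by (rule finitely_many_partition_on[OF insert(1)])
  \<comment> \<open>Dominates the factors \<open>exp (2 ^ card P)\<close> of all partitions at once
    and depends only on \<open>D\<close>.\<close>
  define c where "c = 1 + (\<Sum>P\<in>Ps. exp (2 ^ card P :: real))"
  have c: "c > 0" by (simp add: c_def add_pos_nonneg sum_nonneg)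
  have c_ge: "exp (2 ^ card P) \<le> c" if "P \<in> Ps" for P
  proof -
    have "exp (2 ^ card P) \<le> (\<Sum>P\<in>Ps. exp (2 ^ card P :: real))"
      using that Ps by (intro member_le_sum) auto
    then show ?thesis by (simp add: c_def)
  qed
  \<comment> \<open>The mean of \<open>V\<close> below: \<open>1\<close>, plus two partition
    functions of mean \<open>1\<close> for each partition.\<close>
  define K where "K = 1 + 2 * real (card Ps)"
  have K: "K \<ge> 1" by (simp add: K_def)
  have "chaos_moment n (insert a D) A p \<le> ennreal ((C * c * K * s) powr p)"
    if p: "p \<ge> 2" and s: "s > 0"
      and bound: "\<forall>Q y. partition_on (insert a D) Q \<longrightarrow> unit_arrays n Q y \<longrightarrow>
        sqrt p ^ card Q * \<bar>form n (insert a D) A Q y\<bar> \<le> s" for n A p s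
  proof -
    \<comment> \<open>Controls all weighted forms of the contraction; the summand \<open>1\<close>
      keeps the bound \<open>t\<close> below positive.\<close>
    define V where "V = (\<lambda>g. 1 + (\<Sum>P\<in>Ps. partition_function n a D A P (p / s) g + partition_function n a D A P (- p / s) g))"
    have V_meas [measurable]: "partition_function n a D A P e \<in> borel_measurable (gauss ({a} \<times> {1..n}))"
      if "P \<in> Ps" for P e
      using that insert(1,2) by (intro measurable_partition_function) (auto simp: Ps_def)
    have int_V: "(\<integral>\<^sup>+g. V g \<partial>gauss ({a} \<times> {1..n})) = ennreal K"
    proof -
      interpret prob_space "gauss ({a} \<times> {1..n})" by (rule prob_space_gauss)
      have Z: "(\<integral>\<^sup>+g. partition_function n a D A P e g \<partial>gauss ({a} \<times> {1..n})) = 1" if "P \<in> Ps" for P e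
        using that insert(1,2) by (intro nn_integral_partition_function) (auto simp: Ps_def)
      have Z2: "(\<integral>\<^sup>+g. partition_function n a D A P (p / s) g + partition_function n a D A P (- p / s) g
        \<partial>gauss ({a} \<times> {1..n})) = 1 + 1" if "P \<in> Ps" for P
        using nn_integral_add[OF V_meas[OF that] V_meas[OF that]] Z[OF that] by metis
      have "(\<integral>\<^sup>+g. V g \<partial>gauss ({a} \<times> {1..n})) = (\<integral>\<^sup>+g. 1 \<partial>gauss ({a} \<times> {1..n}))
        + (\<integral>\<^sup>+g. (\<Sum>P\<in>Ps. partition_function n a D A P (p / s) g + partition_function n a D A P (- p / s) g)
          \<partial>gauss ({a} \<times> {1..n}))"
        unfolding V_def by (rule nn_integral_add) measurable
      also have "\<dots> = 1 + (\<Sum>P\<in>Ps. 1 + 1)"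
        by (subst nn_integral_sum) (measurable, simp only: Z2 nn_integral_const emeasure_space_1 mult_1 cong: sum.cong)
      finally have "(\<integral>\<^sup>+g. V g \<partial>gauss ({a} \<times> {1..n})) = 1 + (\<Sum>P\<in>Ps. 1 + 1)" .
      then show ?thesis
        by (simp add: K_def ennreal_of_nat_eq_real_of_nat ennreal_plus ennreal_mult' mult.commute)
    qed
    have "chaos_moment n D (contract n a A g) p \<le> ennreal ((C * c * s) powr p) * V g" for g
    proof (cases "V g = top")
      case True
      then show ?thesis using C c s by (simp add: ennreal_mult_top)
    next
      case False
      then obtain v where v: "V g = ennreal v" "v \<ge> 0" by (cases "V g") auto
      have "1 \<le> V g" by (simp add: V_def)
      then have "v \<ge> 1" using v by simp
      \<comment> \<open>The bound for the contraction at this \<open>g\<close>. Its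
        \<open>p\<close>-th power is linear in \<open>V g\<close>, so only the mean of
        \<open>V\<close> enters afterwards.\<close>
      define t where "t = c * s * v powr (1 / p)"
      have t: "t > 0" using c s \<open>v \<ge> 1\<close> by (simp add: t_def)
      have tp: "t powr p = (c * s) powr p * v"
        using c s p \<open>v \<ge> 1\<close> by (simp add: t_def powr_mult powr_powr)
      have "chaos_moment n D (contract n a A g) p \<le> ennreal ((C * t) powr p)"
      proof (rule IH[OF p t])
        fix P y assume P: "partition_on D P" and y: "unit_arrays n P y"
        let ?f = "sqrt p ^ card P * \<bar>form n D (contract n a A g) P y\<bar>"
        have "P \<in> Ps" using P by (simp add: Ps_def)
        have "ennreal (?f powr p) \<le> ennreal ((exp (2 ^ card P) * s) powr p)
          * (partition_function n a D A P (p / s) g + partition_function n a D A P (- p / s) g)"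
          using p s bound y by (intro form_contract_powr_le[OF insert(1,2) P]) auto
        also have "\<dots> \<le> ennreal ((c * s) powr p) * V g"
        proof (rule mult_mono)
          show "ennreal ((exp (2 ^ card P) * s) powr p) \<le> ennreal ((c * s) powr p)"
            using c_ge[OF \<open>P \<in> Ps\<close>] s p by (intro ennreal_leI powr_mono2 mult_right_mono) auto
          have "partition_function n a D A P (p / s) g + partition_function n a D A P (- p / s) g
            \<le> (\<Sum>P\<in>Ps. partition_function n a D A P (p / s) g + partition_function n a D A P (- p / s) g)"
            by (rule member_le_sum[OF \<open>P \<in> Ps\<close> _ Ps]) simp
          then show "partition_function n a D A P (p / s) g + partition_function n a D A P (- p / s) g \<le> V g"
            unfolding V_def by (rule add_increasing[rotated]) simp
        qed auto
        also have "\<dots> = ennreal (t powr p)"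
          using v by (simp add: tp ennreal_mult')
        finally have "?f powr p \<le> t powr p" by simp
        then show "?f \<le> t"
          using powr_less_mono2[of p t ?f] p t by (meson less_imp_le not_le less_le_trans zero_less_numeral)
      qed
      also have "(C * t) powr p = (C * c * s) powr p * v"
        using C c s p t tp by (simp add: powr_mult)
      finally show ?thesis using v by (simp add: ennreal_mult')
    qed
    then have "chaos_moment n (insert a D) A p
      \<le> (\<integral>\<^sup>+g. ennreal ((C * c * s) powr p) * V g \<partial>gauss ({a} \<times> {1..n}))"
      unfolding chaos_moment_insert[OF insert(1,2)] by (intro nn_integral_mono)
    also have "\<dots> = ennreal ((C * c * s) powr p) * ennreal K"
    proof -
      have "V \<in> borel_measurable (gauss ({a} \<times> {1..n}))" unfolding V_def by measurable
      then show ?thesis by (simp only: nn_integral_cmult int_V)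
    qed
    \<comment> \<open>\<open>K\<close> is at least \<open>1\<close>, so it can be moved under the
      power and join the constant.\<close>
    also have "\<dots> \<le> ennreal ((C * c * s) powr p) * ennreal (K powr p)"
      using K p powr_mono[of 1 p K] by (intro mult_left_mono ennreal_leI) auto
    also have "\<dots> = ennreal ((C * c * K * s) powr p)"
      using C c K s by (simp add: powr_mult ac_simps flip: ennreal_mult')
    finally show ?thesis .
  qed
  moreover have "C * c * K > 0" using C c K by simp
  ultimately show ?case by blast
qed

text \<open>Each index costs at most the factor \<open>9\<close> of
  \<open>gauss_linear_moment_ge\<close>. The block of the new index either is a singleton and
  disappears in the contraction, or merely loses that index.\<close>

lemma chaos_moment_lower:
  assumes "finite D"
  shows "\<exists>c>0. \<forall>n A p Q y. p \<ge> 2 \<longrightarrow> partition_on D Q \<longrightarrow> unit_arrays n Q y \<longrightarrow>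
    ennreal ((c * (sqrt p ^ card Q * \<bar>form n D A Q y\<bar>)) powr p) \<le> chaos_moment n D A p"
  using assms
proof (induction D rule: finite_induct)
  case empty
  have "ennreal ((1 * (sqrt p ^ card Q * \<bar>form n {} A Q y\<bar>)) powr p) \<le> chaos_moment n {} A p"
    if "partition_on {} Q" for n A p Q y
    using that by (simp add: partition_on_empty chaos_moment_empty[of _ _ _ y])
  then show ?case by (metis zero_less_one)
next
  case (insert a D)
  then obtain c where c: "c > 0"
    and IH: "\<And>n A p Q y. p \<ge> 2 \<Longrightarrow> partition_on D Q \<Longrightarrow> unit_arrays n Q y \<Longrightarrow>
    ennreal ((c * (sqrt p ^ card Q * \<bar>form n D A Q y\<bar>)) powr p) \<le> chaos_moment n D A p"
    by metis
  have "ennreal ((c / 9 * (sqrt p ^ card Q * \<bar>form n (insert a D) A Q y\<bar>)) powr p) \<le> chaos_moment n (insert a D) A p"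
    if p: "p \<ge> 2" and Q: "partition_on (insert a D) Q" and y: "unit_arrays n Q y" for n A p Q y
  proof -
    obtain I where I: "I \<in> Q" "a \<in> I" using partition_onD1[OF Q] by auto
    define B where "B = I - {a}"
    define R where "R = Q - {I}"
    have QI: "Q = insert I R" "I \<notin> R" using I by (auto simp: R_def)
    have IB: "I = insert a B" "a \<notin> B" using I by (auto simp: B_def)
    have disj: "disjnt I (\<Union>R)"
      using partition_onD2[OF Q] I by (auto simp: R_def disjnt_def disjoint_def)
    have QR: "partition_on (insert a D - I) R" "I \<subseteq> insert a D"
      using Q unfolding QI(1) partition_on_insert[OF disj] by auto
    have DB: "insert a D - I = D - B" "B \<subseteq> D" using QR(2) insert(2) IB by auto
    have finQ: "finite Q" using finite_elements[OF _ Q] insert(1) by simp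
    then have finR: "finite R" by (simp add: R_def)
    have aR: "a \<notin> I'" if "I' \<in> R" for I'
      using disj I(2) that by (auto simp: disjnt_def)
    have yR: "unit_arrays n R y" using y by (simp add: unit_arrays_def R_def)
    define J where "J = {a} \<times> {1..n}"
    define T where "T w j = fibre_sum n D (slice a A j) B R y w" for w j
    \<comment> \<open>The norm of the fibre sums, which bounds the form by maximising over the array
      of \<open>I\<close> alone; it is split into row \<open>a\<close> and the indices of
      \<open>B\<close>.\<close>
    define H where "H = sqrt (\<Sum>w\<in>multi_indices B n. \<Sum>v\<in>J. (T w (snd v))\<^sup>2)"
    have sumJ: "(\<Sum>v\<in>J. h v) = (\<Sum>j\<in>{1..n}. h (a, j))" for h :: "nat \<times> nat \<Rightarrow> real"
      by (simp add: J_def sum.cartesian_product')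
    have finJ: "finite J" by (simp add: J_def)
    have H: "H \<ge> 0" by (simp add: H_def sum_nonneg)
    have "\<bar>form n (insert a D) A Q y\<bar> \<le> sqrt (\<Sum>w\<in>multi_indices I n. (fibre_sum n (insert a D) A I R y w)\<^sup>2)"
      unfolding QI(1) using insert(1) QR(2) finR QI y by (intro form_insert_le) auto
    also have "(\<Sum>w\<in>multi_indices I n. (fibre_sum n (insert a D) A I R y w)\<^sup>2)
      = (\<Sum>j\<in>{1..n}. \<Sum>w\<in>multi_indices B n. (T w j)\<^sup>2)"
      unfolding IB(1) T_def using insert(2) DB(2) aR by (rule sum_fibre_sum_squares_insert)
    also have "\<dots> = (\<Sum>w\<in>multi_indices B n. \<Sum>v\<in>J. (T w (snd v))\<^sup>2)"
      unfolding sumJ by (subst sum.swap) simp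
    finally have form_le: "\<bar>form n (insert a D) A Q y\<bar> \<le> H" by (simp add: H_def)
    have contr: "fibre_sum n D (contract n a A g) B R y w = (\<Sum>v\<in>J. T w (snd v) * g v)" for g w
      by (simp add: fibre_sum_contract sumJ T_def)
    have "ennreal ((c / 9 * (sqrt p ^ card Q * \<bar>form n (insert a D) A Q y\<bar>)) powr p)
       \<le> ennreal ((c / 9 * (sqrt p ^ card Q * H)) powr p)"
      using c p form_le by (intro ennreal_leI powr_mono2 mult_left_mono) auto
    also have "\<dots> \<le> chaos_moment n (insert a D) A p"
    proof (cases "B = {}")
      \<comment> \<open>Contraction removes the block \<open>{a}\<close>; the lost factor
        \<open>sqrt p\<close> is recovered from the \<open>p\<close>-th moment of one Gaussian
        linear form.\<close>
      case True
      then have R: "partition_on D R" using QR(1) DB by simp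
      define u where "u = (\<lambda>_ :: nat. undefined :: nat)"
      have MI: "multi_indices B n = {u}" by (simp add: True multi_indices_def u_def)
      have form_R: "form n D A' R y = fibre_sum n D A' B R y u" for A'
        by (simp add: form_def fibre_sum_def True u_def restrict_def)
      have card: "card Q = Suc (card R)" using QI finR by simp
      have "ennreal ((c / 9 * (sqrt p ^ card Q * H)) powr p)
        = ennreal ((c * sqrt p ^ card R) powr p) * ennreal ((sqrt p * sqrt (\<Sum>v\<in>J. (T u (snd v))\<^sup>2) / 9) powr p)"
      proof -
        have "c / 9 * (sqrt p ^ card Q * H) = (c * sqrt p ^ card R) * (sqrt p * H / 9)"
          by (simp add: card)
        then have "(c / 9 * (sqrt p ^ card Q * H)) powr p = (c * sqrt p ^ card R) powr p * (sqrt p * H / 9) powr p"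
          using c p H by (simp only:) (intro powr_mult; simp)
        then show ?thesis by (simp add: ennreal_mult' H_def MI)
      qed
      also have "\<dots> \<le> ennreal ((c * sqrt p ^ card R) powr p)
        * (\<integral>\<^sup>+g. ennreal (\<bar>\<Sum>v\<in>J. T u (snd v) * g v\<bar> powr p) \<partial>gauss J)"
        by (intro mult_left_mono gauss_linear_moment_ge finJ p) simp
      also have "\<dots> = (\<integral>\<^sup>+g. ennreal ((c * (sqrt p ^ card R * \<bar>form n D (contract n a A g) R y\<bar>)) powr p) \<partial>gauss J)"
        unfolding form_R contr using c p
        by (simp add: powr_mult mult.assoc ennreal_mult' flip: nn_integral_cmult)
      also have "\<dots> \<le> chaos_moment n (insert a D) A p"
        unfolding chaos_moment_insert[OF insert(1,2)] J_def
        by (intro nn_integral_mono IH p R yR)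
      finally show ?thesis .
    next
      \<comment> \<open>The number of blocks is unchanged, so comparing the \<open>p\<close>-th
        moment of the norm with the second one suffices.\<close>
      case False
      have BR: "disjnt B (\<Union>R)" using disj by (auto simp: IB(1) disjnt_def)
      then have BnR: "B \<notin> R" using False by (auto simp: disjnt_def)
      have P: "partition_on D (insert B R)"
        unfolding partition_on_insert[OF BR] using QR(1) DB False by simp
      have card: "card Q = card (insert B R)" using QI finR BnR by simp
      have "ennreal ((c / 9 * (sqrt p ^ card Q * H)) powr p) \<le> ennreal ((c * (sqrt p ^ card Q * H)) powr p)"
        using c p H by (intro ennreal_leI powr_mono2 mult_right_mono) auto
      also have "\<dots> = ennreal ((c * sqrt p ^ card Q) powr p) * ennreal (H powr p)"
        using c p H by (simp add: powr_mult mult.assoc ennreal_mult')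
      also have "\<dots> \<le> ennreal ((c * sqrt p ^ card Q) powr p)
        * (\<integral>\<^sup>+g. ennreal (sqrt (\<Sum>w\<in>multi_indices B n. (\<Sum>v\<in>J. T w (snd v) * g v)\<^sup>2) powr p) \<partial>gauss J)"
        unfolding H_def by (intro mult_left_mono gauss_norm_moment_ge finJ p) simp
      also have "\<dots> = (\<integral>\<^sup>+g. ennreal ((c * (sqrt p ^ card Q *
          sqrt (\<Sum>w\<in>multi_indices B n. (\<Sum>v\<in>J. T w (snd v) * g v)\<^sup>2))) powr p) \<partial>gauss J)"
        using c p by (simp add: powr_mult mult.assoc ennreal_mult' sum_nonneg flip: nn_integral_cmult)
      also have "\<dots> \<le> chaos_moment n (insert a D) A p"
        unfolding chaos_moment_insert[OF insert(1,2)] J_def[symmetric]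
      proof (rule nn_integral_mono)
        fix g
        \<comment> \<open>The optimal array depends on \<open>g\<close>, which the pointwise bound
          by \<open>IH\<close> allows.\<close>
        obtain z where "unit_arrays n (insert B R) z" and z: "form n D (contract n a A g) (insert B R) z
            = sqrt (\<Sum>w\<in>multi_indices B n. (fibre_sum n D (contract n a A g) B R y w)\<^sup>2)"
          using fibre_sum_norm_attained[OF insert(1) DB(2) finR BnR yR] by blast
        then show "ennreal ((c * (sqrt p ^ card Q *
          sqrt (\<Sum>w\<in>multi_indices B n. (\<Sum>v\<in>J. T w (snd v) * g v)\<^sup>2))) powr p)
          \<le> chaos_moment n D (contract n a A g) p"
          using IH[OF p P, of n z "contract n a A g"] by (simp add: contr card sum_nonneg)
      qed
      finally show ?thesis .
    qed
    finally show ?thesis .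
  qed
  moreover have "c / 9 > 0" using c by simp
  ultimately show ?case by blast
qed

section \<open>Partition norms and the law of the chaos\<close>

lemma partition_norm_altdef:
  "partition_norm d n A P = Sup {form n {1..d} A P x | x. unit_arrays n P x}"
  by (simp add: partition_norm_def form_def unit_arrays_def)

text \<open>An entry of a unit array is at most \<open>1\<close> in absolute value. This crude bound
  makes the set under the supremum in \<open>partition_norm\<close> bounded.\<close>

lemma abs_form_le:
  assumes P: "partition_on {1..d} P" and x: "unit_arrays n P x"
  shows "\<bar>form n {1..d} A P x\<bar> \<le> (\<Sum>i\<in>multi_indices {1..d} n. \<bar>A i\<bar>)"
proof -
  have "\<bar>A i * (\<Prod>I\<in>P. x I (restrict i I))\<bar> \<le> \<bar>A i\<bar>" if i: "i \<in> multi_indices {1..d} n" for i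
  proof -
    have "\<bar>x I (restrict i I)\<bar> \<le> 1" if "I \<in> P" for I
    proof -
      have I: "I \<subseteq> {1..d}" using P that by (auto simp: partition_on_def)
      then have "finite (multi_indices I n)"
        by (intro finite_multi_indices) (rule finite_subset, auto)
      have "(x I (restrict i I))\<^sup>2 \<le> (\<Sum>u\<in>multi_indices I n. (x I u)\<^sup>2)"
        by (rule member_le_sum[where f = "\<lambda>u. (x I u)\<^sup>2", OF restrict_multi_indices[OF i I] _ \<open>finite (multi_indices I n)\<close>]) simp
      also have "\<dots> \<le> 1" using x that by (auto simp: unit_arrays_def)
      finally show ?thesis by (simp add: abs_square_le_1)
    qed
    then have "(\<Prod>I\<in>P. \<bar>x I (restrict i I)\<bar>) \<le> (\<Prod>I\<in>P. 1)"
      by (intro prod_mono) auto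
    then show ?thesis by (simp add: abs_mult abs_prod mult_left_le)
  qed
  then show ?thesis
    unfolding form_def by (intro order_trans[OF sum_abs] sum_mono)
qed

lemma form_le_partition_norm:
  assumes "partition_on {1..d} P" "unit_arrays n P x"
  shows "form n {1..d} A P x \<le> partition_norm d n A P"
  unfolding partition_norm_altdef
proof (rule cSup_upper)
  show "bdd_above {form n {1..d} A P x | x. unit_arrays n P x}"
    using abs_form_le[OF assms(1)] by (intro bdd_aboveI[of _ "\<Sum>i\<in>multi_indices {1..d} n. \<bar>A i\<bar>"]) (auto intro: abs_le_D1)
qed (use assms in auto)

text \<open>Changing the sign of one array changes the sign of the form; \<open>d \<ge> 1\<close>
  provides a block.\<close>

lemma abs_form_le_partition_norm:
  assumes P: "partition_on {1..d} P" and x: "unit_arrays n P x" and d: "d \<ge> 1"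
  shows "\<bar>form n {1..d} A P x\<bar> \<le> partition_norm d n A P"
proof -
  obtain I where I: "I \<in> P" using partition_onD1[OF P] d by fastforce
  have fin: "finite P" by (rule finite_elements[OF _ P]) simp
  define z where "z = x(I := \<lambda>u. - x I u)"
  have z: "unit_arrays n P z" using x by (auto simp: unit_arrays_def z_def)
  have "(\<Prod>I'\<in>P. z I' (restrict i I')) = - (\<Prod>I'\<in>P. x I' (restrict i I'))" for i
  proof -
    have "(\<Prod>I'\<in>P - {I}. z I' (restrict i I')) = (\<Prod>I'\<in>P - {I}. x I' (restrict i I'))"
      by (intro prod.cong) (auto simp: z_def)
    then show ?thesis by (simp add: prod.remove[OF fin I]) (simp add: z_def)
  qed
  then have "form n {1..d} A P z = - form n {1..d} A P x"
    by (simp add: form_def sum_negf)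
  then show ?thesis
    using form_le_partition_norm[OF P x, of A] form_le_partition_norm[OF P z, of A] by simp
qed

lemma partition_norm_le:
  assumes "\<And>x. unit_arrays n P x \<Longrightarrow> form n {1..d} A P x \<le> K"
  shows "partition_norm d n A P \<le> K"
  unfolding partition_norm_altdef
proof (rule cSup_least)
  have "unit_arrays n P (\<lambda>_ _. 0)" by (simp add: unit_arrays_def)
  then show "{form n {1..d} A P x | x. unit_arrays n P x} \<noteq> {}" by blast
qed (use assms in auto)

lemma partition_norm_nonneg:
  assumes "partition_on {1..d} P" "d \<ge> 1"
  shows "0 \<le> partition_norm d n A P"
  using abs_form_le_partition_norm[OF assms(1) _ assms(2), of n "\<lambda>_ _. 0" A]
  by (force simp: unit_arrays_def)

text \<open>Every partition of \<open>{1..d}\<close> has between \<open>1\<close> and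
  \<open>d\<close> blocks, so grouping by the number of blocks loses nothing.\<close>

lemma m_norm_altdef:
  assumes d: "d \<ge> 1" and p: "p > 0"
  shows "m_norm d n p A = (\<Sum>P | partition_on {1..d} P. sqrt p ^ card P * partition_norm d n A P)"
proof -
  have fin: "finite {P. partition_on {1..d} P}" by (rule finitely_many_partition_on) simp
  have card: "card P \<in> {1..d}" if P: "partition_on {1..d} P" for P
  proof -
    have "finite P" by (rule finite_elements[OF _ P]) simp
    moreover have "P \<noteq> {}" using partition_onD1[OF P] d by auto
    ultimately have "card P \<ge> 1" by (simp add: Suc_le_eq card_gt_0_iff)
    moreover have "card P \<le> d"
    proof -
      have "card P = (\<Sum>I\<in>P. 1)" by simp
      also have "\<dots> \<le> (\<Sum>I\<in>P. card I)"
      proof (rule sum_mono)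
        fix I assume I: "I \<in> P"
        have "finite I" using I partition_onD1[OF P] by (metis Sup_upper finite_atLeastAtMost finite_subset)
        then show "1 \<le> card I" using I partition_onD3[OF P] by (auto simp: Suc_le_eq card_gt_0_iff)
      qed
      also have "\<dots> = card {1..d}"
        using partition_onD1[OF P] by (intro product_partition[OF P, symmetric]) (metis Sup_upper finite_atLeastAtMost finite_subset)
      finally show ?thesis by simp
    qed
    ultimately show ?thesis by simp
  qed
  have pow: "p powr (real k / 2) = sqrt p ^ k" for k
    using p by (simp add: powr_half_sqrt[symmetric] powr_power)
  have "m_norm d n p A = (\<Sum>k\<in>{1..d}. \<Sum>P | P \<in> {P. partition_on {1..d} P} \<and> card P = k. sqrt p ^ card P * partition_norm d n A P)"
    unfolding m_norm_def partitions_into_def sum_distrib_left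
    by (intro sum.cong refl) (auto simp: pow)
  also have "\<dots> = (\<Sum>P | partition_on {1..d} P. sqrt p ^ card P * partition_norm d n A P)"
    using card by (intro sum.group fin) auto
  finally show ?thesis .
qed

section \<open>Transfer between arbitrary sample spaces and the Gaussian product measure\<close>

lemma gauss_law:
  fixes M :: "'w measure"
  assumes M: "prob_space M" "indep_std_normals M d n g" and dn: "d \<ge> 1" "n \<ge> 1"
  defines "J \<equiv> {1..d} \<times> {1..n}"
  defines "G \<equiv> (\<lambda>\<omega>. \<lambda>v\<in>J. g (fst v) (snd v) \<omega>)"
  shows "G \<in> measurable M (Pi\<^sub>M J (\<lambda>_. borel))" "distr M (Pi\<^sub>M J (\<lambda>_. borel)) G = gauss J"
proof -
  interpret prob_space M by fact
  have X: "g (fst v) (snd v) \<in> borel_measurable M" "distr M borel (g (fst v) (snd v)) = std_gauss" if "v \<in> J" for v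
  proof -
    have "distributed M lborel (g (fst v) (snd v)) std_normal_density"
      using M(2) that by (auto simp: indep_std_normals_def J_def)
    then show "g (fst v) (snd v) \<in> borel_measurable M" "distr M borel (g (fst v) (snd v)) = std_gauss"
      by (auto simp: distributed_def cong: distr_cong)
  qed
  show "G \<in> measurable M (Pi\<^sub>M J (\<lambda>_. borel))"
    unfolding G_def by (intro measurable_restrict X)
  have "indep_vars (\<lambda>_. borel) (\<lambda>v. g (fst v) (snd v)) J"
    using M(2) by (simp add: indep_std_normals_def J_def case_prod_unfold)
  moreover have "J \<noteq> {}" using dn by (auto simp: J_def)
  ultimately have "distr M (Pi\<^sub>M J (\<lambda>_. borel)) G = Pi\<^sub>M J (\<lambda>v. distr M borel (g (fst v) (snd v)))"
    unfolding G_def using X(1) by (subst (asm) indep_vars_iff_distr_eq_PiM') auto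
  also have "\<dots> = gauss J"
    unfolding gauss_def using X(2) by (intro PiM_cong) auto
  finally show "distr M (Pi\<^sub>M J (\<lambda>_. borel)) G = gauss J" .
qed

lemma Lp_norm_decoupled_chaos:
  assumes "prob_space M" "indep_std_normals M d n g" "d \<ge> 1" "n \<ge> 1"
  shows "Lp_norm M p (decoupled_chaos d n A g) = Lp_norm (gauss ({1..d} \<times> {1..n})) p (chaos n {1..d} A)"
proof -
  let ?G = "\<lambda>\<omega>. \<lambda>v\<in>{1..d} \<times> {1..n}. g (fst v) (snd v) \<omega>"
  note law = gauss_law[OF assms]
  have "chaos n {1..d} A (?G \<omega>) = decoupled_chaos d n A g \<omega>" for \<omega>
    unfolding chaos_def decoupled_chaos_def
    by (intro sum.cong arg_cong2[of _ _ _ _ "(*)"] prod.cong refl) (auto simp: multi_indices_def)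
  note eq = this
  have meas: "(\<lambda>x. \<bar>chaos n {1..d} A x\<bar> powr p) \<in> borel_measurable (Pi\<^sub>M ({1..d} \<times> {1..n}) (\<lambda>_. borel))"
    using measurable_chaos[of n "{1..d}" A] by measurable
  show ?thesis
    unfolding Lp_norm_def law(2)[symmetric] integral_distr[OF law(1) meas] eq ..
qed

text \<open>The coordinate maps realise the hypotheses on the type
  \<open>nat \<times> nat \<Rightarrow> real\<close>, which allows passing from
  \<open>moment_bounds\<close> back to the product measure.\<close>

lemma indep_std_normals_gauss:
  assumes "d \<ge> 1" "n \<ge> 1"
  shows "indep_std_normals (gauss ({1..d} \<times> {1..n})) d n (\<lambda>j i \<omega>. \<omega> (j, i))"
proof -
  define J where "J = {1..d} \<times> {1..n}"
  interpret prob_space "gauss J" by (rule prob_space_gauss)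
  have X: "(\<lambda>\<omega>. \<omega> v) \<in> borel_measurable (gauss J)" "distr (gauss J) borel (\<lambda>\<omega>. \<omega> v) = std_gauss" if "v \<in> J" for v
  proof -
    show "(\<lambda>\<omega>. \<omega> v) \<in> borel_measurable (gauss J)" using that by (rule measurable_coord)
    have "distr (gauss J) borel (\<lambda>\<omega>. \<omega> v) = distr (gauss J) std_gauss (\<lambda>\<omega>. \<omega> v)"
      by (intro distr_cong) auto
    also have "\<dots> = std_gauss"
      unfolding gauss_def using that prob_space_std_gauss by (intro distr_PiM_component)
    finally show "distr (gauss J) borel (\<lambda>\<omega>. \<omega> v) = std_gauss" .
  qed
  have "J \<noteq> {}" using assms by (auto simp: J_def)
  have "distr (gauss J) (Pi\<^sub>M J (\<lambda>_. borel)) (\<lambda>\<omega>. \<lambda>v\<in>J. \<omega> v) = distr (gauss J) (gauss J) (\<lambda>\<omega>. \<omega>)"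
    by (rule distr_cong) (simp_all add: sets_gauss, simp add: gauss_def space_PiM PiE_restrict)
  also have "\<dots> = Pi\<^sub>M J (\<lambda>v. distr (gauss J) borel (\<lambda>\<omega>. \<omega> v))"
    using X(2) by (simp add: distr_id gauss_def[of J, symmetric]) (simp add: gauss_def cong: PiM_cong)
  finally have "indep_vars (\<lambda>_. borel) (\<lambda>v \<omega>. \<omega> v) J"
    using X(1) \<open>J \<noteq> {}\<close> by (subst indep_vars_iff_distr_eq_PiM') auto
  moreover have "distributed (gauss J) lborel (\<lambda>\<omega>. \<omega> v) std_normal_density" if "v \<in> J" for v
    using X[OF that] by (simp add: distributed_def cong: distr_cong)
  ultimately show ?thesis
    by (auto simp: indep_std_normals_def J_def case_prod_unfold)
qed

text \<open>\<open>bounds\<close> mentions no sample space: it follows from the canonical type and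
  yields every type, with the same constant.\<close>

lemma moment_bounds_iff_gauss:
  assumes d: "d \<ge> 1"
  defines "N \<equiv> \<lambda>n (p :: real) A. Lp_norm (gauss ({1..d} \<times> {1..n})) p (chaos n {1..d} A)"
  defines "bounds \<equiv> \<lambda>C. \<forall>n\<ge>1. \<forall>A. \<forall>p. 2 \<le> (p::real) \<longrightarrow> 1 / C * m_norm d n p A \<le> N n p A \<and> N n p A \<le> C * m_norm d n p A"
  shows "bounds C \<Longrightarrow> moment_bounds TYPE('w) d C"
    and "moment_bounds TYPE(nat \<times> nat \<Rightarrow> real) d C \<Longrightarrow> bounds C"
proof -
  show "moment_bounds TYPE('w) d C" if "bounds C"
    unfolding moment_bounds_def
  proof (intro allI impI)
    fix n A and p :: real and M :: "'w measure" and g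
    assume "1 \<le> n" "2 \<le> p" "prob_space M" "indep_std_normals M d n g"
    then show "1 / C * m_norm d n p A \<le> Lp_norm M p (decoupled_chaos d n A g) \<and>
      Lp_norm M p (decoupled_chaos d n A g) \<le> C * m_norm d n p A"
      using that d by (simp add: Lp_norm_decoupled_chaos bounds_def N_def)
  qed
  show "bounds C" if "moment_bounds TYPE(nat \<times> nat \<Rightarrow> real) d C"
    unfolding bounds_def
  proof (intro allI impI)
    fix n :: nat and A and p :: real assume n: "1 \<le> n" and p: "2 \<le> p"
    note can = prob_space_gauss indep_std_normals_gauss[OF d n]
    show "1 / C * m_norm d n p A \<le> N n p A \<and> N n p A \<le> C * m_norm d n p A"
      unfolding N_def Lp_norm_decoupled_chaos[OF can d n, symmetric]
      using that n p can unfolding moment_bounds_def by blast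
  qed
qed

section \<open>The two-sided estimate with one constant\<close>

lemma Lp_norm_chaos_bounds:
  assumes d: "d \<ge> 1"
  shows "\<exists>C>0. \<forall>n\<ge>1. \<forall>A. \<forall>p\<ge>2.
    1 / C * m_norm d n p A \<le> Lp_norm (gauss ({1..d} \<times> {1..n})) p (chaos n {1..d} A) \<and>
    Lp_norm (gauss ({1..d} \<times> {1..n})) p (chaos n {1..d} A) \<le> C * m_norm d n p A"
proof -
  obtain C where C: "C > 0" and upper: "\<And>n A p s. p \<ge> 2 \<Longrightarrow> s > 0 \<Longrightarrow>
      (\<And>Q y. partition_on {1..d} Q \<Longrightarrow> unit_arrays n Q y \<Longrightarrow> sqrt p ^ card Q * \<bar>form n {1..d} A Q y\<bar> \<le> s) \<Longrightarrow>
      chaos_moment n {1..d} A p \<le> ennreal ((C * s) powr p)"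
    using chaos_moment_upper[of "{1..d}"] by (metis finite_atLeastAtMost)
  obtain c where c: "c > 0" and lower: "\<And>n A p Q y. p \<ge> 2 \<Longrightarrow> partition_on {1..d} Q \<Longrightarrow> unit_arrays n Q y \<Longrightarrow>
      ennreal ((c * (sqrt p ^ card Q * \<bar>form n {1..d} A Q y\<bar>)) powr p) \<le> chaos_moment n {1..d} A p"
    using chaos_moment_lower[of "{1..d}"] by (metis finite_atLeastAtMost)
  define Ps where "Ps = {P. partition_on {1..d} P}"
  have Ps: "finite Ps" unfolding Ps_def by (rule finitely_many_partition_on) simp
  \<comment> \<open>\<open>C\<close> serves the upper estimate; the lower one is summed over all
    partitions, whence \<open>card Ps / c\<close>.\<close>
  define K where "K = max C (card Ps / c)"
  have K: "K > 0" using C by (simp add: K_def)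
  have "1 / K * m_norm d n p A \<le> Lp_norm (gauss ({1..d} \<times> {1..n})) p (chaos n {1..d} A) \<and>
    Lp_norm (gauss ({1..d} \<times> {1..n})) p (chaos n {1..d} A) \<le> K * m_norm d n p A"
    if p: "p \<ge> 2" for n A p
  proof -
    define m where "m = m_norm d n p A"
    have m: "m = (\<Sum>P\<in>Ps. sqrt p ^ card P * partition_norm d n A P)"
      using p d by (simp add: m_def Ps_def m_norm_altdef)
    have term_nonneg: "0 \<le> sqrt p ^ card P * partition_norm d n A P" if "P \<in> Ps" for P
      using that p d by (simp add: Ps_def partition_norm_nonneg)
    then have m_nonneg: "m \<ge> 0" unfolding m by (rule sum_nonneg)
    define L where "L = Lp_norm (gauss ({1..d} \<times> {1..n})) p (chaos n {1..d} A)"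
    have L: "L \<ge> 0" by (simp add: L_def Lp_norm_def)
    \<comment> \<open>\<open>s\<close> stays strictly above \<open>m\<close>, since
      \<open>upper\<close> asks for \<open>s > 0\<close> and \<open>m\<close> may vanish.\<close>
    have up: "chaos_moment n {1..d} A p \<le> ennreal ((C * s) powr p)" if s: "s > m" for s
    proof (rule upper[OF p])
      show "s > 0" using s m_nonneg by simp
      fix Q y assume Q: "partition_on {1..d} Q" and y: "unit_arrays n Q y"
      have "sqrt p ^ card Q * \<bar>form n {1..d} A Q y\<bar> \<le> sqrt p ^ card Q * partition_norm d n A Q"
        using p by (intro mult_left_mono abs_form_le_partition_norm Q y d) auto
      also have "\<dots> \<le> m"
        unfolding m using Q term_nonneg Ps by (intro member_le_sum) (auto simp: Ps_def)
      finally show "sqrt p ^ card Q * \<bar>form n {1..d} A Q y\<bar> \<le> s" using s by simp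
    qed
    have meas: "(\<lambda>g. \<bar>chaos n {1..d} A g\<bar> powr p) \<in> borel_measurable (gauss ({1..d} \<times> {1..n}))"
      using measurable_chaos[of n "{1..d}" A] by measurable
    \<comment> \<open>Finiteness gives integrability, by which the Bochner integral in
      \<open>Lp_norm\<close> agrees with the extended one.\<close>
    have "chaos_moment n {1..d} A p < \<infinity>"
      using up[of "m + 1"] by (auto intro: le_less_trans)
    then have "integrable (gauss ({1..d} \<times> {1..n})) (\<lambda>g. \<bar>chaos n {1..d} A g\<bar> powr p)"
      unfolding chaos_moment_def using meas by (intro integrableI_nonneg) auto
    then have "chaos_moment n {1..d} A p = ennreal (\<integral>g. \<bar>chaos n {1..d} A g\<bar> powr p \<partial>gauss ({1..d} \<times> {1..n}))"
      unfolding chaos_moment_def by (simp add: nn_integral_eq_integral)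
    also have "(\<integral>g. \<bar>chaos n {1..d} A g\<bar> powr p \<partial>gauss ({1..d} \<times> {1..n})) = L powr p"
      using p by (simp add: L_def Lp_norm_def powr_powr)
    finally have moment: "chaos_moment n {1..d} A p = ennreal (L powr p)" .
    have powr_le: "a \<le> b" if "a powr p \<le> b powr p" "0 \<le> b" for a b :: real
      using powr_less_mono2[of p b a] p that by (meson not_le less_le_trans zero_less_numeral)
    have "L \<le> C * m"
    \<comment> \<open>Letting \<open>s\<close> decrease to \<open>m\<close> removes the strict
      inequality.\<close>
    proof (rule field_le_epsilon)
      fix e :: real assume e: "e > 0"
      have "L powr p \<le> (C * (m + e / C)) powr p"
        using up[of "m + e / C"] e C unfolding moment by simp
      then have "L \<le> C * (m + e / C)"
        by (rule powr_le) (use C e m_nonneg in simp)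
      then show "L \<le> C * m + e" using C by (simp add: distrib_left)
    qed
    also have "\<dots> \<le> K * m"
      using m_nonneg by (intro mult_right_mono) (auto simp: K_def)
    finally have "L \<le> K * m" .
    moreover have "m \<le> K * L"
    proof -
      have "sqrt p ^ card P * partition_norm d n A P \<le> L / c" if P: "P \<in> Ps" for P
      proof -
        have "form n {1..d} A P y \<le> L / (c * sqrt p ^ card P)" if y: "unit_arrays n P y" for y
        proof -
          have "(c * (sqrt p ^ card P * \<bar>form n {1..d} A P y\<bar>)) powr p \<le> L powr p"
            using lower[OF p _ y, of A] P unfolding moment Ps_def by simp
          then have "c * (sqrt p ^ card P * \<bar>form n {1..d} A P y\<bar>) \<le> L"
            using L by (rule powr_le)
          then have "\<bar>form n {1..d} A P y\<bar> \<le> L / (c * sqrt p ^ card P)"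
            using c p by (simp add: pos_le_divide_eq mult_ac)
          then show ?thesis by simp
        qed
        then have "partition_norm d n A P \<le> L / (c * sqrt p ^ card P)"
          by (rule partition_norm_le)
        then show ?thesis using c p by (simp add: field_simps)
      qed
      then have "m \<le> (\<Sum>P\<in>Ps. L / c)" unfolding m by (rule sum_mono)
      also have "\<dots> = card Ps / c * L" by simp
      also have "\<dots> \<le> K * L" using L by (intro mult_right_mono) (auto simp: K_def)
      finally show ?thesis .
    qed
    then have "1 / K * m \<le> L"
      using K by (simp add: pos_divide_le_eq mult.commute)
    ultimately show ?thesis
      unfolding L_def m_def by (rule conjI[rotated])
  qed
  then show ?thesis by (intro exI[of _ K] conjI[OF K] allI impI)
qed

theorem theorem1:
  fixes d :: nat
  assumes "d \<ge> 1"
  shows "(\<exists>C>0. moment_bounds TYPE(nat \<times> nat \<Rightarrow> real) d C) \<and>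
         (\<forall>C>0. moment_bounds TYPE(nat \<times> nat \<Rightarrow> real) d C \<longrightarrow> moment_bounds TYPE('w) d C)"
proof (intro conjI allI impI)
  obtain C where "C > 0" and C: "\<forall>n\<ge>1. \<forall>A. \<forall>p\<ge>2.
    1 / C * m_norm d n p A \<le> Lp_norm (gauss ({1..d} \<times> {1..n})) p (chaos n {1..d} A) \<and>
    Lp_norm (gauss ({1..d} \<times> {1..n})) p (chaos n {1..d} A) \<le> C * m_norm d n p A"
    using Lp_norm_chaos_bounds[OF assms] by (elim exE conjE)
  then show "\<exists>C>0. moment_bounds TYPE(nat \<times> nat \<Rightarrow> real) d C"
    by (intro exI[of _ C] conjI moment_bounds_iff_gauss(1)[OF assms])
next
  fix C :: real assume "moment_bounds TYPE(nat \<times> nat \<Rightarrow> real) d C"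
  then show "moment_bounds TYPE('w) d C"
    by (rule moment_bounds_iff_gauss(1)[OF assms moment_bounds_iff_gauss(2)[OF assms]])
qed

end
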